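(* There exist an integer $n\geq3$, a subgroup $F\leq S_n$, an involution $\tau$ of the index set of the $F$-orbits on $\{1,\dots,n\}$, a $\tau$-legal labelling $l$ of the $n$-regular tree $T$, and free uniform lattices $\Gamma,\Gamma'\leq U^{(l)}(F)$ such that no uniform lattice $\Lambda\leq U^{(l)}(F)$ contains both a $U^{(l)}(F)$-conjugate of $\Gamma$ and a $U^{(l)}(F)$-conjugate of $\Gamma'$.
   Context: $VT$ is the vertex set of $T$ and $ET$ is the set of oriented edges; each $e\in ET$ has an origin $o(e)$, a terminus $t(e)$ and an inverse edge $\bar e$. $E(x)$ is the set of $e\in ET$ with $o(e)=x$. $\operatorname{Aut}(T)$ is the automorphism group of $T$ (inversions allowed). Let $F\leq S_n$ and let $\{1,\dots,n\}=\sqcup_{i\in I}\Omega_i$ be the partition into $F$-orbits. Let $\tau$ be an involution of $I$ (i.e. $\tau^2=\mathrm{id}$; $\tau$ may be trivial). A map $l:ET\to\{1,\dots,n\}$ is a $\tau$-legal labelling of $T$ if (1) for all $x\in VT$ the map $l_x:E(x)\to\{1,\dots,n\}$, $e\mapsto l(e)$, is a bijection, and (2) for all $e\in ET$, if $l(e)\in\Omega_i$ then $l(\bar e)\in\Omega_{\tau(i)}$. The universal group of $T$ with respect to $l$ and $F$ is $$U^{(l)}(F)=\{g\in\operatorname{Aut}(T)\mid l_{gx}\circ g\circ l_x^{-1}\in F\text{ for all }x\in VT\},$$ where $g$ here denotes the induced bijection $E(x)\to E(gx)$. A subgroup $\Gamma\leq\operatorname{Aut}(T)$ is a uniform lattice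 if it acts properly and cocompactly on $T$, i.e. its action on $VT$ has finite stabilisers and finitely many orbits; a uniform lattice in $U^{(l)}(F)$ is a uniform lattice of $\operatorname{Aut}(T)$ contained in $U^{(l)}(F)$. It is free if it acts freely on $T$ (no non-trivial element fixes a point of $T$; in particular no element inverts an edge). *)

theory Defs
  imports
    "HOL-Algebra.Sym_Groups"
    "HOL-Algebra.Group_Action"
    "Graph_Theory.Bidirected_Digraph"
    "Graph_Theory.Digraph_Component"
begin

text \<open>
  Graphs are graphs in the sense of Serre: a digraph whose arcs are the oriented edges, with origin
  \<open>tail\<close>, terminus \<open>head\<close> and edge inversion \<open>bar\<close> (a fixed-point-free involution on the arcs, and
  by the convention of \<^locale>\<open>bidirected_digraph\<close> the identity elsewhere). The set \<open>E(x)\<close> is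
  \<open>out_arcs T x\<close>.

  A closed walk of the form \<open>[e, bar e]\<close> is a cycle of the digraph but not a circuit of the
  graph. All other digraph cycles (loops, pairs of parallel edges, longer cycles) are circuits.
\<close>

definition serre_tree :: "('v, 'e) pre_digraph \<Rightarrow> ('e \<Rightarrow> 'e) \<Rightarrow> bool" where
  "serre_tree T bar \<longleftrightarrow> bidirected_digraph T bar \<and> connected T \<and>
     (\<forall>p. pre_digraph.cycle T p \<longrightarrow> (\<exists>e\<in>arcs T. p = [e, bar e]))"

definition regular_tree :: "nat \<Rightarrow> ('v, 'e) pre_digraph \<Rightarrow> ('e \<Rightarrow> 'e) \<Rightarrow> bool" where
  "regular_tree n T bar \<longleftrightarrow> serre_tree T bar \<and>
     (\<forall>x\<in>verts T. finite (out_arcs T x) \<and> card (out_arcs T x) = n)"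

text \<open>
  An automorphism is a pair consisting of its action on vertices and its action on oriented edges.
  Both are total functions that are the identity off \<open>verts T\<close> and \<open>arcs T\<close> respectively, so equal
  automorphisms are equal pairs.
\<close>

definition aut_group ::
    "('v, 'e) pre_digraph \<Rightarrow> ('e \<Rightarrow> 'e) \<Rightarrow> (('v \<Rightarrow> 'v) \<times> ('e \<Rightarrow> 'e)) monoid" where
  "aut_group T bar =
     \<lparr> carrier = {g. fst g permutes verts T \<and> snd g permutes arcs T \<and>
         (\<forall>e\<in>arcs T. tail T (snd g e) = fst g (tail T e) \<and>
                     head T (snd g e) = fst g (head T e) \<and>
                     snd g (bar e) = bar (snd g e))},
       mult = (\<lambda>g h. (fst g \<circ> fst h, snd g \<circ> snd h)),
       one = (id, id) \<rparr>"

text \<open>The set of orbits also serves as the index set \<open>I\<close> of the partition into orbits.\<close>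

definition perm_orbits :: "nat \<Rightarrow> (nat \<Rightarrow> nat) set \<Rightarrow> nat set set" where
  "perm_orbits n F = orbits ((sym_group n)\<lparr>carrier := F\<rparr>) {1..n} (\<lambda>p. p)"

definition orbit_involution :: "nat \<Rightarrow> (nat \<Rightarrow> nat) set \<Rightarrow> (nat set \<Rightarrow> nat set) \<Rightarrow> bool" where
  "orbit_involution n F \<tau> \<longleftrightarrow>
     (\<forall>\<Omega>\<in>perm_orbits n F. \<tau> \<Omega> \<in> perm_orbits n F \<and> \<tau> (\<tau> \<Omega>) = \<Omega>)"

definition legal_labelling ::
    "nat \<Rightarrow> (nat \<Rightarrow> nat) set \<Rightarrow> (nat set \<Rightarrow> nat set) \<Rightarrow>
     ('v, 'e) pre_digraph \<Rightarrow> ('e \<Rightarrow> 'e) \<Rightarrow> ('e \<Rightarrow> nat) \<Rightarrow> bool" where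
  "legal_labelling n F \<tau> T bar l \<longleftrightarrow>
     (\<forall>x\<in>verts T. bij_betw l (out_arcs T x) {1..n}) \<and>
     (\<forall>e\<in>arcs T. \<forall>\<Omega>\<in>perm_orbits n F. l e \<in> \<Omega> \<longrightarrow> l (bar e) \<in> \<tau> \<Omega>)"

text \<open>
  The permutation \<open>l\<^bsub>gx\<^esub> \<circ> g \<circ> l\<^bsub>x\<^esub>\<^sup>-\<^sup>1\<close> of \<open>{1..n}\<close>, extended by the identity, as the elements of
  \<^const>\<open>sym_group\<close> are.
\<close>

definition local_action ::
    "nat \<Rightarrow> ('v, 'e) pre_digraph \<Rightarrow> ('e \<Rightarrow> nat) \<Rightarrow> ('v \<Rightarrow> 'v) \<times> ('e \<Rightarrow> 'e) \<Rightarrow> 'v \<Rightarrow> nat \<Rightarrow> nat" where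
  "local_action n T l g x =
     (\<lambda>i. if i \<in> {1..n} then l (snd g (inv_into (out_arcs T x) l i)) else i)"

definition universal_group ::
    "nat \<Rightarrow> (nat \<Rightarrow> nat) set \<Rightarrow> ('v, 'e) pre_digraph \<Rightarrow> ('e \<Rightarrow> 'e) \<Rightarrow> ('e \<Rightarrow> nat) \<Rightarrow>
     (('v \<Rightarrow> 'v) \<times> ('e \<Rightarrow> 'e)) set" where
  "universal_group n F T bar l =
     {g \<in> carrier (aut_group T bar). \<forall>x\<in>verts T. local_action n T l g x \<in> F}"

definition uniform_lattice ::
    "('v, 'e) pre_digraph \<Rightarrow> ('e \<Rightarrow> 'e) \<Rightarrow> (('v \<Rightarrow> 'v) \<times> ('e \<Rightarrow> 'e)) set \<Rightarrow> bool" where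
  "uniform_lattice T bar \<Gamma> \<longleftrightarrow> subgroup \<Gamma> (aut_group T bar) \<and>
     (\<forall>x\<in>verts T. finite (stabilizer ((aut_group T bar)\<lparr>carrier := \<Gamma>\<rparr>) fst x)) \<and>
     finite (orbits ((aut_group T bar)\<lparr>carrier := \<Gamma>\<rparr>) (verts T) fst)"

text \<open>
  An automorphism fixes an interior point of an edge iff it fixes the oriented edge or inverts it.
\<close>

definition acts_freely ::
    "('v, 'e) pre_digraph \<Rightarrow> ('e \<Rightarrow> 'e) \<Rightarrow> (('v \<Rightarrow> 'v) \<times> ('e \<Rightarrow> 'e)) set \<Rightarrow> bool" where
  "acts_freely T bar \<Gamma> \<longleftrightarrow>
     (\<forall>g\<in>\<Gamma>. g \<noteq> \<one>\<^bsub>aut_group T bar\<^esub> \<longrightarrow>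
        (\<forall>x\<in>verts T. fst g x \<noteq> x) \<and> (\<forall>e\<in>arcs T. snd g e \<noteq> e \<and> snd g e \<noteq> bar e))"

definition conjugate ::
    "('a, 'b) monoid_scheme \<Rightarrow> 'a \<Rightarrow> 'a set \<Rightarrow> 'a set" where
  "conjugate G u H = u <#\<^bsub>G\<^esub> H #>\<^bsub>G\<^esub> inv\<^bsub>G\<^esub> u"

end

theory Submission
  imports Defs
begin

text \<open>
  The lattices are built from labellings of one regular tree \<open>T\<close>. Suppose that the labels at every
  vertex form a bijection with \<open>{1..n}\<close> and that inverting an edge changes its label by a
  fixed-point-free involution \<open>\<sigma>\<close> of \<open>{1..n}\<close>. Then the automorphisms that preserve labels form a
  free group acting simply transitively on the vertices; the quotient is a rose whose loops are
  the pairs \<open>{a, \<sigma> a}\<close>. Two labellings that differ at each vertex by a permutation in \<open>F\<close> have the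
  same universal group. So, besides the labelling \<open>l\<close> of \<open>T\<close> with involution \<open>\<sigma>\<close>, take a second one
  with another involution \<open>\<rho>\<close>, related to \<open>l\<close> through \<open>F\<close>
  (\<open>related_labelling_exists\<close>); the lattices \<open>\<Gamma>\<close> and \<open>\<Gamma>'\<close> are the two label groups.

  Assume that a uniform lattice \<open>\<Lambda>\<close> of the universal group contains a conjugate of each. A conjugate
  of a label group contains the label group of a translated labelling with the same involution, so
  one may forget about conjugation. Let \<open>S\<close> be the finite stabiliser in \<open>\<Lambda>\<close> of the base vertex, let
  \<open>A\<close> be its image in \<open>F\<close> under the local action and \<open>K\<close> the kernel. Two facts about
  \<open>S\<close> contradict each other (\<open>no_common_lattice\<close>).

  \<^item> Every edge at the base vertex can be turned round by an element of either label group. Comparing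
    the two elements shows that \<open>A\<close> is large: for some \<open>f \<in> F\<close>, every label \<open>b\<close> has an \<open>\<alpha> \<in> A\<close>
    with \<open>f (\<alpha> (\<sigma> b)) = \<rho> (f b)\<close>.
  \<^item> Turning round the edge with label \<open>a0\<close> by the first label group conjugates its stabiliser onto
    the stabiliser of the edge with label \<open>\<sigma> a0\<close>. Both stabilisers lie in \<open>S\<close> and contain \<open>K\<close>, so
    their quotients by \<open>K\<close> have the same order and, by the Jordan-Hoelder theorem, the same
    composition factors. These quotients are the stabilisers in \<open>A\<close> of \<open>a0\<close> and of \<open>\<sigma> a0\<close>. If the
    first is abelian, the second is therefore soluble.

  It remains to find \<open>F\<close>, \<open>\<sigma>\<close> and \<open>\<rho>\<close> for which the first fact makes \<open>A\<close> insoluble, the stabiliser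
  of \<open>a0\<close> in \<open>F\<close> is abelian, and the derived subgroup of \<open>F\<close> fixes \<open>\<sigma> a0\<close>. Take as labels four
  copies of the alternating group of degree five, and let its product with a cyclic group of order
  60 act by left translation on three copies and through a 60-cycle on the remaining one. The
  involution \<open>\<sigma>\<close> exchanges a translated copy, which contains \<open>a0\<close>, with the rotated copy, and the
  other two translated copies with each other. Replacing the second exchange by the exchange along
  \<open>x \<mapsto> x\<^sup>-\<^sup>1\<close> gives \<open>\<rho>\<close>. The first fact then puts every
  three-cycle into the projection of \<open>A\<close> to the alternating group.
\<close>

section \<open>Derived series\<close>

text \<open>
  This replaces the comparison of composition factors. The derived series of \<open>h ` H1\<close> is at least as
  large as that of \<open>H2\<close>, and after its first step the one of \<open>H1\<close> runs inside that of \<open>K\<close>. Hence at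
  the index where the orders for \<open>H2\<close> become constant, the terms for \<open>K\<close> and \<open>H2\<close> have the same
  order and coincide.
\<close>

lemma (in group) derived_series_eventually_below:
  assumes h: "group_hom G G h" and H1: "subgroup H1 G" "finite H1" and H2: "subgroup H2 G"
    and K: "subgroup K G"
    and incl: "derived G H1 \<subseteq> K" "K \<subseteq> H2" "H2 \<subseteq> h ` H1"
  shows "\<exists>k. (derived G ^^ k) H2 \<subseteq> K"
proof -
  let ?D = "\<lambda>k. derived G ^^ k"
  interpret h: group_hom G G h by (rule h)
  have fin: "finite (?D k X)" if "subgroup X G" "finite X" for k X
  proof (rule finite_subset[OF _ that(2)])
    show "?D k X \<subseteq> X"
      by (induction k) (use derived_incl[OF _ that(1)] in auto)
  qed
  have fH2: "finite H2" using H1(2) incl(3) finite_subset by blast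
  have fK: "finite K" using fH2 incl(2) finite_subset by blast
  obtain k where k: "\<And>j. card (?D k H2) \<le> card (?D j H2)"
    using ex_has_least_nat[of "\<lambda>_. True" 0 "\<lambda>k. card (?D k H2)"] by auto
  have "card (?D k H2) \<le> card (?D (Suc k) H2)" by (rule k)
  also have "\<dots> \<le> card (?D (Suc k) (h ` H1))"
  proof (rule card_mono)
    show "?D (Suc k) H2 \<subseteq> ?D (Suc k) (h ` H1)" by (rule mono_exp_of_derived[OF incl(3)])
    show "finite (?D (Suc k) (h ` H1))"
      using h.subgroup_img_is_subgroup[OF H1(1)] H1(2) by (intro fin) auto
  qed
  also have "\<dots> = card (h ` ?D (Suc k) H1)"
    by (simp only: h.exp_of_derived_img[OF subgroup.subset[OF H1(1)]])
  also have "\<dots> \<le> card (?D (Suc k) H1)" by (rule card_image_le[OF fin[OF H1]])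
  also have "?D (Suc k) H1 = ?D k (derived G H1)" by (simp add: funpow_swap1)
  also have "card \<dots> \<le> card (?D k K)"
    by (rule card_mono[OF fin[OF K fK] mono_exp_of_derived[OF incl(1)]])
  finally have "card (?D k H2) \<le> card (?D k K)" .
  then have "?D k K = ?D k H2"
    using card_seteq[OF fin[OF H2 fH2] mono_exp_of_derived[OF incl(2)]] by blast
  moreover have "?D k K \<subseteq> K"
    by (induction k) (use derived_incl[OF _ K] in auto)
  ultimately show ?thesis by blast
qed

lemma (in group) exp_of_derived_consistent:
  assumes "subgroup S G" "H \<subseteq> S"
  shows "(derived (G\<lparr>carrier := S\<rparr>) ^^ k) H = (derived G ^^ k) H"
proof (induction k)
  case (Suc k)
  have "(derived G ^^ k) H \<subseteq> S"
    by (induction k) (use derived_incl[OF _ assms(1)] assms(2) in auto)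
  then show ?case using Suc derived_consistent[OF _ assms(1)] by simp
qed simp

lemma aut_group_is_group:
  assumes bar: "\<And>e. e \<in> arcs T \<Longrightarrow> bar e \<in> arcs T"
  shows "group (aut_group T bar)"
proof (rule groupI)
  fix g assume g: "g \<in> carrier (aut_group T bar)"
  then have p: "fst g permutes verts T" "snd g permutes arcs T" by (auto simp: aut_group_def)
  let ?h = "(inv' (fst g), inv' (snd g))"
  have "tail T (inv' (snd g) e) = inv' (fst g) (tail T e) \<and>
        head T (inv' (snd g) e) = inv' (fst g) (head T e) \<and>
        inv' (snd g) (bar e) = bar (inv' (snd g) e)" if e: "e \<in> arcs T" for e
  proof -
    define d where "d = inv' (snd g) e"
    have d: "d \<in> arcs T" "e = snd g d"
      using e permutes_inv[OF p(2)] permutes_inverses[OF p(2)] permutes_in_image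
      by (fastforce simp: d_def)+
    have "tail T e = fst g (tail T d)" "head T e = fst g (head T d)" "bar e = snd g (bar d)"
      using g d by (auto simp: aut_group_def)
    then show ?thesis
      using permutes_inverses[OF p(1)] permutes_inverses[OF p(2)] by (simp add: d_def[symmetric])
  qed
  then have "?h \<in> carrier (aut_group T bar)"
    using permutes_inv[OF p(1)] permutes_inv[OF p(2)] by (auto simp: aut_group_def)
  moreover have "?h \<otimes>\<^bsub>aut_group T bar\<^esub> g = \<one>\<^bsub>aut_group T bar\<^esub>"
    using permutes_inv_o(2)[OF p(1)] permutes_inv_o(2)[OF p(2)] by (auto simp: aut_group_def)
  ultimately show "\<exists>h\<in>carrier (aut_group T bar). h \<otimes>\<^bsub>aut_group T bar\<^esub> g = \<one>\<^bsub>aut_group T bar\<^esub>"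
    by blast
qed (auto simp: aut_group_def permutes_compose permutes_id permutes_in_image)

section \<open>The tree of reduced words\<close>

text \<open>
  The vertices of the tree are the words without a letter following its \<open>\<sigma>\<close>-partner. The last letter
  of a word is the head of the list, so that the neighbour of \<open>a # w\<close> towards the root is \<open>w\<close>.
\<close>

fun reduced :: "nat \<Rightarrow> (nat \<Rightarrow> nat) \<Rightarrow> nat list \<Rightarrow> bool" where
  "reduced n \<sigma> [] \<longleftrightarrow> True"
| "reduced n \<sigma> [a] \<longleftrightarrow> a \<in> {1..n}"
| "reduced n \<sigma> (a # b # w) \<longleftrightarrow> a \<in> {1..n} \<and> a \<noteq> \<sigma> b \<and> reduced n \<sigma> (b # w)"

definition word_arcs :: "nat \<Rightarrow> (nat \<Rightarrow> nat) \<Rightarrow> (nat list \<times> nat list) set" where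
  "word_arcs n \<sigma> = {(u, w). reduced n \<sigma> u \<and> reduced n \<sigma> w \<and> (\<exists>a. w = a # u \<or> u = a # w)}"

definition word_tree :: "nat \<Rightarrow> (nat \<Rightarrow> nat) \<Rightarrow> (nat list, nat list \<times> nat list) pre_digraph" where
  "word_tree n \<sigma> = \<lparr>verts = {w. reduced n \<sigma> w}, arcs = word_arcs n \<sigma>, tail = fst, head = snd\<rparr>"

definition word_bar :: "nat \<Rightarrow> (nat \<Rightarrow> nat) \<Rightarrow> nat list \<times> nat list \<Rightarrow> nat list \<times> nat list" where
  "word_bar n \<sigma> e = (if e \<in> word_arcs n \<sigma> then prod.swap e else e)"

text \<open>
  An arc away from the root carries the added letter. The label of an arc towards the root is
  dictated by \<open>\<sigma>\<close>, since inversion of arcs must act on labels through \<open>\<sigma>\<close>.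
\<close>

definition word_lab :: "(nat \<Rightarrow> nat) \<Rightarrow> nat list \<times> nat list \<Rightarrow> nat" where
  "word_lab \<sigma> e = (if length (fst e) < length (snd e) then hd (snd e) else \<sigma> (hd (fst e)))"

locale word_tree_labels =
  fixes n :: nat and \<sigma> :: "nat \<Rightarrow> nat"
  assumes \<sigma>_in: "a \<in> {1..n} \<Longrightarrow> \<sigma> a \<in> {1..n}"
    and \<sigma>_\<sigma>: "a \<in> {1..n} \<Longrightarrow> \<sigma> (\<sigma> a) = a"
    and \<sigma>_neq: "a \<in> {1..n} \<Longrightarrow> \<sigma> a \<noteq> a"
begin

abbreviation "T \<equiv> word_tree n \<sigma>"
abbreviation "bar \<equiv> word_bar n \<sigma>"
abbreviation "lab \<equiv> word_lab \<sigma>"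
abbreviation "G \<equiv> aut_group T bar"
abbreviation "red \<equiv> reduced n \<sigma>"

lemma T_simps [simp]:
  "verts T = {w. red w}" "arcs T = word_arcs n \<sigma>" "tail T = fst" "head T = snd"
  by (simp_all add: word_tree_def)

lemma reduced_Cons: "red (a # w) \<longleftrightarrow> a \<in> {1..n} \<and> red w \<and> (w \<noteq> [] \<longrightarrow> a \<noteq> \<sigma> (hd w))"
  by (cases w) auto

lemma arcs_red: "(u, w) \<in> word_arcs n \<sigma> \<Longrightarrow> red u \<and> red w"
  by (auto simp: word_arcs_def)

lemma arcs_sym: "(u, w) \<in> word_arcs n \<sigma> \<Longrightarrow> (w, u) \<in> word_arcs n \<sigma>"
  by (auto simp: word_arcs_def)

lemma arc_Cons: "red (a # w) \<Longrightarrow> (w, a # w) \<in> word_arcs n \<sigma> \<and> (a # w, w) \<in> word_arcs n \<sigma>"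
  by (auto simp: word_arcs_def reduced_Cons)

lemma bar_arc: "(u, w) \<in> word_arcs n \<sigma> \<Longrightarrow> bar (u, w) = (w, u)"
  by (simp add: word_bar_def)

lemma out_arcs_iff: "e \<in> out_arcs T x \<longleftrightarrow> e \<in> word_arcs n \<sigma> \<and> fst e = x"
  by (auto simp: out_arcs_def)

lemma out_arcs_pair:
  assumes "e \<in> out_arcs T x"
  shows "e = (x, snd e) \<and> (x, snd e) \<in> word_arcs n \<sigma> \<and> red (snd e)"
  using assms arcs_red by (cases e) (auto simp: out_arcs_iff)

lemma lab_bar: "e \<in> word_arcs n \<sigma> \<Longrightarrow> lab (bar e) = \<sigma> (lab e)"
  by (auto simp: word_bar_def word_lab_def word_arcs_def reduced_Cons \<sigma>_\<sigma>)

text \<open>Connectedness of the tree as an induction principle, from an arbitrary base vertex.\<close>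

lemma word_induct [consumes 2, case_names base step]:
  assumes "red x" "red y" "P x"
    and step: "\<And>u w. (u, w) \<in> word_arcs n \<sigma> \<Longrightarrow> P u \<Longrightarrow> P w"
  shows "P y"
proof -
  have "P []" using assms(1,3)
    by (induction x) (use step arc_Cons reduced_Cons in blast)+
  then show ?thesis using assms(2)
    by (induction y) (use step arc_Cons reduced_Cons in blast)+
qed

lemma bidirected: "bidirected_digraph T bar"
proof -
  interpret wf_digraph T by unfold_locales (auto simp: word_arcs_def)
  show ?thesis
    by (rule bidirected_digraphI) (auto simp: word_bar_def word_arcs_def)
qed

lemma connected_T: "connected T"
proof -
  let ?M = "mk_symmetric T"
  have ends: "(u, w) \<in> arcs_ends (with_proj ?M)" if "(u, w) \<in> word_arcs n \<sigma>" for u w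
    using that by (force simp: mk_symmetric_def arcs_ends_def arc_to_ends_def)
  have v: "verts (with_proj ?M) = {w. red w}" by (simp add: mk_symmetric_def)
  have "x \<rightarrow>\<^sup>*\<^bsub>with_proj ?M\<^esub> y" if "red x" "red y" for x y
    using that
  proof (induction rule: word_induct)
    case base
    then show ?case using that v by (auto simp: reachable_def)
  next
    case (step u w)
    then show ?case using ends[of u w] v arcs_red[of u w] unfolding reachable_def
      by (metis mem_Collect_eq rtrancl_on_into_rtrancl_on)
  qed
  moreover have "red []" by simp
  ultimately show ?thesis unfolding connected_def strongly_connected_def v by blast
qed

lemma closed_walk_nth:
  assumes "pre_digraph.cas T u p v" "p \<noteq> []"
  shows "snd (last p) = v \<and> (\<forall>i<length p. fst (p ! i) = (if i = 0 then u else snd (p ! (i - 1))))"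
  using assms
proof (induction p arbitrary: u)
  case (Cons e p)
  interpret pre_digraph T .
  have c: "fst e = u" "cas (snd e) p v" using Cons.prems by (auto simp: cas.simps)
  show ?case
  proof (cases "p = []")
    case True
    then show ?thesis using c by (simp add: cas.simps)
  next
    case False
    have l: "snd (last p) = v"
      and n: "\<And>i. i < length p \<Longrightarrow> fst (p ! i) = (if i = 0 then snd e else snd (p ! (i - 1)))"
      using Cons.IH[OF c(2) False] by auto
    have "fst ((e # p) ! i) = (if i = 0 then u else snd ((e # p) ! (i - 1)))"
      if "i < length (e # p)" for i
    proof (cases i)
      case (Suc j)
      then show ?thesis using that n[of j] by (cases j) auto
    qed (simp add: c(1))
    then show ?thesis using False l by (metis last_ConsR)
  qed
qed simp

text \<open>
  At a vertex of a cycle that is farthest from the root, both neighbours on the cycle are the unique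
  neighbour towards the root. Since a cycle has no other repetition of vertices, it has length two.
\<close>

lemma cycle_backtracks:
  assumes "pre_digraph.cycle T p"
  shows "\<exists>e\<in>arcs T. p = [e, bar e]"
proof -
  interpret pre_digraph T .
  obtain u where u: "awalk u p u" "distinct (tl (awalk_verts u p))" "p \<noteq> []"
    using assms by (auto simp: cycle_def)
  have cas: "cas u p u" and arcs: "set p \<subseteq> word_arcs n \<sigma>"
    using u(1) by (auto simp: awalk_def)
  have dist: "distinct (map snd p)"
    using u(2) awalk_verts_conv'[OF cas] u(3) by (simp split: if_splits)
  \<comment> \<open>Indices are cyclic: \<open>prv\<close> is the predecessor modulo the length of the cycle.\<close>
  let ?L = "length p"
  define prv where "prv i = (if i = 0 then ?L - 1 else i - 1)" for i
  have L: "?L > 0" using u(3) by simp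
  have fst_p: "fst (p ! i) = snd (p ! prv i)" if "i < ?L" for i
    using closed_walk_nth[OF cas u(3)] that u(3) by (auto simp: prv_def last_conv_nth)
  obtain i where i: "i < ?L" "\<And>j. j < ?L \<Longrightarrow> length (snd (p ! j)) \<le> length (snd (p ! i))"
  proof -
    let ?M = "(\<lambda>j. length (snd (p ! j))) ` {..<?L}"
    have "Max ?M \<in> ?M" using L by (intro Max_in) auto
    then obtain i where "i < ?L" "length (snd (p ! i)) = Max ?M" by auto
    then show thesis using that[of i] by auto
  qed
  define j where "j = (if i = ?L - 1 then 0 else i + 1)"
  have j: "j < ?L" "prv j = i" using i(1) by (auto simp: j_def prv_def)
  have k: "prv i < ?L" using i(1) by (auto simp: prv_def)
  define v where "v = snd (p ! i)"
  have pi: "p ! i = (snd (p ! prv i), v)" "p ! j = (v, snd (p ! j))"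
    using fst_p[OF i(1)] fst_p[OF j(1)] j(2) by (auto simp: v_def prod_eq_iff)
  have ai: "(snd (p ! prv i), v) \<in> word_arcs n \<sigma>" "(v, snd (p ! j)) \<in> word_arcs n \<sigma>"
    using arcs i(1) j(1) pi nth_mem by (metis subsetD)+
  have eq: "snd (p ! prv i) = tl v" "snd (p ! j) = tl v"
    using ai i(2)[OF k] i(2)[OF j(1)] by (auto simp: word_arcs_def v_def[symmetric])
  have "prv i = j"
    using dist k j(1) eq nth_eq_iff_index_eq[of "map snd p" "prv i" j] by simp
  moreover have "?L \<noteq> 1"
  proof
    assume "?L = 1"
    then have "prv i = i" using i(1) by (auto simp: prv_def)
    then show False using ai(1) by (auto simp: word_arcs_def v_def)
  qed
  ultimately have L2: "?L = 2" "i = 0 \<and> j = 1 \<or> i = 1 \<and> j = 0"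
    using i(1) by (auto simp: prv_def j_def split: if_splits)
  have ba: "bar (p ! i) = p ! j" "bar (p ! j) = p ! i"
    using ai pi eq by (auto simp: bar_arc)
  have "p = [p ! 0, p ! 1]"
    using L2(1) by (simp add: list_eq_iff_nth_eq less_2_cases_iff nth_Cons')
  moreover have "p ! 0 \<in> arcs T" using subsetD[OF arcs nth_mem[OF L]] by simp
  ultimately show ?thesis using ba L2(2) by metis
qed

definition nbr :: "nat list \<Rightarrow> nat \<Rightarrow> nat list" where
  "nbr x a = (if x \<noteq> [] \<and> a = \<sigma> (hd x) then tl x else a # x)"

lemma lab_bij:
  assumes "red x"
  shows "bij_betw lab (out_arcs T x) {1..n}"
proof (rule bij_betw_byWitness[where f' = "\<lambda>a. (x, nbr x a)"])
  show "\<forall>e\<in>out_arcs T x. (x, nbr x (lab e)) = e"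
    by (auto simp: out_arcs_iff word_arcs_def word_lab_def nbr_def reduced_Cons)
  show "\<forall>a\<in>{1..n}. lab (x, nbr x a) = a"
    by (auto simp: word_lab_def nbr_def)
  show "lab ` out_arcs T x \<subseteq> {1..n}"
    by (auto simp: out_arcs_iff word_arcs_def word_lab_def reduced_Cons \<sigma>_in
        simp del: atLeastAtMost_iff One_nat_def)
  show "(\<lambda>a. (x, nbr x a)) ` {1..n} \<subseteq> out_arcs T x"
    using assms by (auto simp: out_arcs_iff word_arcs_def nbr_def reduced_Cons neq_Nil_conv split: if_splits)
qed

lemma regular_T: "regular_tree n T bar"
proof -
  have "finite (out_arcs T x) \<and> card (out_arcs T x) = n" if "red x" for x
    using lab_bij[OF that] bij_betw_finite bij_betw_same_card by force
  then show ?thesis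
    unfolding regular_tree_def serre_tree_def
    using bidirected connected_T cycle_backtracks by auto
qed

lemma group_G: "group G"
  by (rule aut_group_is_group) (auto simp: word_arcs_def word_bar_def)

lemma G_simps [simp]: "mult G = (\<lambda>g h. (fst g \<circ> fst h, snd g \<circ> snd h))" "one G = (id, id)"
  by (simp_all add: aut_group_def)

lemma aut_arc:
  assumes "g \<in> carrier G" "(u, w) \<in> word_arcs n \<sigma>"
  shows "snd g (u, w) = (fst g u, fst g w) \<and> (fst g u, fst g w) \<in> word_arcs n \<sigma>"
proof -
  have "snd g (u, w) = (fst g u, fst g w)"
    using assms by (fastforce simp: aut_group_def prod_eq_iff)
  moreover have "snd g (u, w) \<in> word_arcs n \<sigma>"
    using assms permutes_in_image by (fastforce simp: aut_group_def)
  ultimately show ?thesis by simp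
qed

lemma aut_red: "g \<in> carrier G \<Longrightarrow> red (fst g x) \<longleftrightarrow> red x"
  using permutes_in_image[of "fst g" "{w. red w}" x] by (auto simp: aut_group_def)

text \<open>The tree has no multiple edges, so the action on vertices determines an automorphism.\<close>

lemma aut_eqI:
  assumes "g \<in> carrier G" "h \<in> carrier G" "\<And>x. red x \<Longrightarrow> fst g x = fst h x"
  shows "g = h"
proof -
  have "fst g x = fst h x" for x
    using assms permutes_not_in[of "fst g" "{w. red w}"] permutes_not_in[of "fst h" "{w. red w}"]
    by (cases "red x") (auto simp: aut_group_def)
  moreover have "snd g e = snd h e" for e
  proof (cases "e \<in> word_arcs n \<sigma>")
    case True
    then show ?thesis using assms aut_arc arcs_red by (metis prod.collapse)
  next
    case False
    then show ?thesis
      using assms permutes_not_in[of "snd g" "word_arcs n \<sigma>"] permutes_not_in[of "snd h" "word_arcs n \<sigma>"]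
      by (auto simp: aut_group_def)
  qed
  ultimately show ?thesis by (simp add: prod_eq_iff fun_eq_iff)
qed

section \<open>Groups of label-preserving automorphisms\<close>

text \<open>
  Such a labelling presents the tree as the universal cover of a rose with one loop for each pair
  \<open>{a, \<rho> a}\<close>. Asking \<open>\<rho>\<close> to have no fixed points excludes half-edges, that is, inversions.
\<close>

definition labelling :: "(nat \<Rightarrow> nat) \<Rightarrow> (nat list \<times> nat list \<Rightarrow> nat) \<Rightarrow> bool" where
  "labelling \<rho> m \<longleftrightarrow> (\<forall>x. red x \<longrightarrow> bij_betw m (out_arcs T x) {1..n}) \<and>
     (\<forall>e\<in>word_arcs n \<sigma>. m (bar e) = \<rho> (m e)) \<and> (\<forall>a\<in>{1..n}. \<rho> a \<noteq> a)"

text \<open>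
  Here \<open>g\<close> is any map on vertices. Bijectivity is a consequence (\<open>preserves_bij\<close>), which allows
  automorphisms to be constructed by recursion from the root.
\<close>

definition preserves :: "(nat list \<times> nat list \<Rightarrow> nat) \<Rightarrow> (nat list \<Rightarrow> nat list) \<Rightarrow> bool" where
  "preserves m g \<longleftrightarrow> (\<forall>u w. (u, w) \<in> word_arcs n \<sigma> \<longrightarrow>
     (g u, g w) \<in> word_arcs n \<sigma> \<and> m (g u, g w) = m (u, w))"

definition label_group :: "(nat list \<times> nat list \<Rightarrow> nat) \<Rightarrow> ((nat list \<Rightarrow> nat list) \<times> (nat list \<times> nat list \<Rightarrow> nat list \<times> nat list)) set" where
  "label_group m = {g \<in> carrier G. \<forall>e\<in>word_arcs n \<sigma>. m (snd g e) = m e}"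

lemma labelling_lab: "labelling \<sigma> lab"
  using lab_bij lab_bar \<sigma>_neq by (auto simp: labelling_def)

lemma label_range:
  assumes "labelling \<rho> m" "e \<in> word_arcs n \<sigma>"
  shows "m e \<in> {1..n}"
proof -
  have "red (fst e)" "e \<in> out_arcs T (fst e)"
    using assms(2) arcs_red[of "fst e" "snd e"] by (auto simp: out_arcs_iff)
  then show ?thesis using assms(1) bij_betwE unfolding labelling_def by blast
qed

lemma arc_unique:
  assumes "labelling \<rho> m" "(x, u) \<in> word_arcs n \<sigma>" "(x, w) \<in> word_arcs n \<sigma>" "m (x, u) = m (x, w)"
  shows "u = w"
proof -
  have inj: "inj_on m (out_arcs T x)"
    using assms(1) arcs_red[OF assms(2)] by (auto simp: labelling_def bij_betw_def)
  have "(x, u) = (x, w)"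
    by (rule inj_onD[OF inj assms(4)]) (use assms(2,3) out_arcs_iff in auto)
  then show ?thesis by simp
qed

lemma arc_exists:
  assumes "labelling \<rho> m" "red x" "a \<in> {1..n}"
  obtains w where "(x, w) \<in> word_arcs n \<sigma>" "m (x, w) = a"
proof -
  have "a \<in> m ` out_arcs T x"
    using assms by (auto simp: labelling_def bij_betw_def)
  then show thesis using that by (auto simp: out_arcs_iff)
qed

text \<open>A path from \<open>x\<close> is determined by the labels of its arcs, and these are preserved.\<close>

lemma preserves_unique:
  assumes "labelling \<rho> m" "preserves m g" "preserves m h" "red x" "red y" "g x = h x"
  shows "g y = h y"
  using assms(4-6)
proof (induction rule: word_induct)
  case (step u w)
  then show ?case
    using arc_unique[OF assms(1), of "g u" "g w" "h w"] assms(2,3)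
    unfolding preserves_def by metis
qed auto

text \<open>The image is closed under neighbours, because all labels occur at every vertex of the source.\<close>

lemma preserves_surj:
  assumes "labelling \<rho> m" "preserves m g" "red x" "red (g x)" "red y"
  shows "\<exists>z. red z \<and> g z = y"
  using assms(4,5)
proof (induction rule: word_induct)
  case base
  then show ?case using assms(3) by blast
next
  case (step v w)
  then obtain u where u: "red u" "g u = v" by blast
  obtain z where z: "(u, z) \<in> word_arcs n \<sigma>" "m (u, z) = m (v, w)"
    using arc_exists[OF assms(1) u(1)] label_range[OF assms(1) step(1)] by metis
  then have "g z = w"
    using arc_unique[OF assms(1), of v "g z" w] assms(2) u(2) step(1) by (auto simp: preserves_def)
  then show ?case using arcs_red[OF z(1)] by blast
qed

text \<open>The developing map: follow from \<open>y\<close> the labels along the path from the root.\<close>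

primrec develop :: "(nat list \<times> nat list \<Rightarrow> nat) \<Rightarrow> nat list \<Rightarrow> nat list \<Rightarrow> nat list" where
  "develop m y [] = y"
| "develop m y (a # w) = (SOME v. (develop m y w, v) \<in> word_arcs n \<sigma> \<and>
     m (develop m y w, v) = m (w, a # w))"

lemma preserves_develop:
  assumes m: "labelling \<rho> m" and y: "red y"
  shows "preserves m (develop m y)"
proof -
  have step: "(develop m y w, develop m y (a # w)) \<in> word_arcs n \<sigma> \<and>
      m (develop m y w, develop m y (a # w)) = m (w, a # w)"
    if dw: "red (develop m y w)" "red (a # w)" for a w
  proof -
    have "m (w, a # w) \<in> {1..n}" using label_range[OF m] arc_Cons[OF dw(2)] by blast
    then obtain v where "(develop m y w, v) \<in> word_arcs n \<sigma> \<and> m (develop m y w, v) = m (w, a # w)"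
      using arc_exists[OF m dw(1)] by metis
    then show ?thesis unfolding develop.simps by (rule someI)
  qed
  have r: "red (develop m y w)" if "red w" for w
    using that
  proof (induction w)
    case Nil
    then show ?case using y by simp
  next
    case (Cons a w)
    then show ?case using step arcs_red reduced_Cons by blast
  qed
  have down: "(develop m y w, develop m y (a # w)) \<in> word_arcs n \<sigma> \<and>
      m (develop m y w, develop m y (a # w)) = m (w, a # w)" if "red (a # w)" for a w
    using step[OF r that] that reduced_Cons by blast
  have up: "(develop m y (a # w), develop m y w) \<in> word_arcs n \<sigma> \<and>
      m (develop m y (a # w), develop m y w) = m (a # w, w)" if "red (a # w)" for a w
  proof -
    have "m (v, u) = \<rho> (m (u, v))" if "(u, v) \<in> word_arcs n \<sigma>" for u v
      using m that bar_arc[OF that] by (force simp: labelling_def)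
    then show ?thesis using down[OF that] arc_Cons[OF that] arcs_sym by metis
  qed
  show ?thesis
    unfolding preserves_def
  proof (intro allI impI)
    fix u w assume uw: "(u, w) \<in> word_arcs n \<sigma>"
    then consider a where "w = a # u" | a where "u = a # w" by (auto simp: word_arcs_def)
    then show "(develop m y u, develop m y w) \<in> word_arcs n \<sigma> \<and>
        m (develop m y u, develop m y w) = m (u, w)"
      using down up arcs_red[OF uw] by cases blast+
  qed
qed

text \<open>
  Surjectivity holds for every label-preserving map, so injectivity can be obtained from a right
  inverse: a label-preserving map \<open>h\<close> from the root to a preimage of the root satisfies
  \<open>g \<circ> h = id\<close> by uniqueness, and \<open>h\<close> is surjective as well.
\<close>

lemma preserves_bij:
  assumes m: "labelling \<rho> m" and g: "preserves m g" "red (g [])"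
  shows "bij_betw g {w. red w} {w. red w}"
proof -
  have red_g: "red (g x)" if "red x" for x
  proof (rule word_induct[of "[]" x "\<lambda>x. red (g x)"])
    show "red (g w)" if "(u, w) \<in> word_arcs n \<sigma>" for u w
    proof -
      have "(g u, g w) \<in> word_arcs n \<sigma>" using that g(1) by (simp add: preserves_def)
      then show ?thesis using arcs_red by blast
    qed
  qed (use that g(2) in auto)
  obtain z where z: "red z" "g z = []"
    using preserves_surj[OF m g(1) _ g(2), of "[]"] by auto
  define h where "h = develop m z"
  have h: "preserves m h" "h [] = z"
    using preserves_develop[OF m z(1)] by (auto simp: h_def)
  have "preserves m (g \<circ> h)" "preserves m id"
    using g(1) h(1) by (auto simp: preserves_def)
  then have gh: "g (h x) = x" if "red x" for x
    using preserves_unique[OF m, of "g \<circ> h" id "[]" x] that z h(2) by auto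
  have sh: "\<exists>x'. red x' \<and> h x' = x" if "red x" for x
    using preserves_surj[OF m h(1), of "[]" x] that z h(2) by auto
  have "inj_on g {w. red w}"
    using gh sh by (metis inj_onI mem_Collect_eq)
  moreover have "g ` {w. red w} = {w. red w}"
    using red_g preserves_surj[OF m g(1) _ g(2)] by (auto simp: image_iff)
  ultimately show ?thesis by (simp add: bij_betw_def)
qed

lemma label_group_transitive_root:
  assumes m: "labelling \<rho> m" and y: "red y"
  shows "\<exists>g\<in>label_group m. fst g [] = y"
proof -
  define g where "g = develop m y"
  have g: "preserves m g" "g [] = y" using preserves_develop[OF m y] by (auto simp: g_def)
  have bij: "bij_betw g {w. red w} {w. red w}" using preserves_bij[OF m g(1)] g(2) y by simp
  define p where "p x = (if red x then g x else x)" for x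
  define q where "q e = (if e \<in> word_arcs n \<sigma> then (g (fst e), g (snd e)) else e)" for e
  have pg: "bij_betw p {w. red w} {w. red w}"
    using bij bij_betw_cong[of "{w. red w}" p g] by (auto simp: p_def)
  then have p: "p permutes {w. red w}"
    by (rule bij_imp_permutes) (auto simp: p_def)
  have q_arc: "q e \<in> word_arcs n \<sigma> \<and> m (q e) = m e" if "e \<in> word_arcs n \<sigma>" for e
    using that g(1) by (cases e) (auto simp: q_def preserves_def)
  have "inj_on q (word_arcs n \<sigma>)"
  proof (rule inj_onI)
    fix e d assume "e \<in> word_arcs n \<sigma>" "d \<in> word_arcs n \<sigma>" "q e = q d"
    then show "e = d"
      using bij arcs_red[of "fst e" "snd e"] arcs_red[of "fst d" "snd d"]
      by (auto simp: q_def bij_betw_def inj_on_def prod_eq_iff)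
  qed
  moreover have "\<exists>d\<in>word_arcs n \<sigma>. e = q d" if e: "e \<in> word_arcs n \<sigma>" for e
  proof -
    obtain v w where vw: "e = (v, w)" by (cases e)
    have "v \<in> g ` {w. red w}" using bij e vw arcs_red by (auto simp: bij_betw_def)
    then obtain u where u: "red u" "g u = v" by auto
    obtain z where z: "(u, z) \<in> word_arcs n \<sigma>" "m (u, z) = m (v, w)"
      using arc_exists[OF m u(1)] label_range[OF m e] vw by metis
    then have "g z = w"
      using arc_unique[OF m, of v "g z" w] g(1) u(2) e vw by (auto simp: preserves_def)
    then show ?thesis using z(1) u(2) vw by (intro bexI[of _ "(u, z)"]) (auto simp: q_def)
  qed
  ultimately have "bij_betw q (word_arcs n \<sigma>) (word_arcs n \<sigma>)"
    using q_arc by (auto simp: bij_betw_def image_iff)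
  then have q: "q permutes word_arcs n \<sigma>"
    by (rule bij_imp_permutes) (auto simp: q_def)
  have "(p, q) \<in> carrier G"
    using p q q_arc unfolding aut_group_def
    by (auto simp: q_def p_def word_bar_def dest: arcs_red arcs_sym)
  then have "(p, q) \<in> label_group m" using q_arc by (simp add: label_group_def)
  then show ?thesis using g(2) by (intro bexI[of _ "(p, q)"]) (auto simp: p_def)
qed

lemma label_group_preserves: "g \<in> label_group m \<Longrightarrow> preserves m (fst g)"
  using aut_arc unfolding label_group_def preserves_def by (metis (mono_tags, lifting) mem_Collect_eq)

lemma label_group_subgroup: "subgroup (label_group m) G"
proof -
  interpret group G by (rule group_G)
  show ?thesis
  proof (rule subgroupI)
    show "label_group m \<noteq> {}" using one_closed by (auto simp: label_group_def intro!: exI[of _ id])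
  next
    fix g assume g: "g \<in> label_group m"
    then have gc: "g \<in> carrier G" "inv\<^bsub>G\<^esub> g \<in> carrier G" by (auto simp: label_group_def)
    have "snd g \<circ> snd (inv\<^bsub>G\<^esub> g) = id" using r_inv[OF gc(1)] by simp
    then have gi: "snd g (snd (inv\<^bsub>G\<^esub> g) e) = e" for e by (metis comp_apply id_apply)
    have "m (snd (inv\<^bsub>G\<^esub> g) e) = m e" if "e \<in> word_arcs n \<sigma>" for e
    proof -
      have "snd (inv\<^bsub>G\<^esub> g) e \<in> word_arcs n \<sigma>"
        using that aut_arc[OF gc(2), of "fst e" "snd e"] by simp
      then have "m (snd g (snd (inv\<^bsub>G\<^esub> g) e)) = m (snd (inv\<^bsub>G\<^esub> g) e)"
        using g unfolding label_group_def by blast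
      then show ?thesis by (simp add: gi)
    qed
    then show "inv\<^bsub>G\<^esub> g \<in> label_group m" using gc by (simp add: label_group_def)
  next
    fix g h assume g: "g \<in> label_group m" "h \<in> label_group m"
    then have "g \<otimes>\<^bsub>G\<^esub> h \<in> carrier G" by (simp add: label_group_def del: G_simps)
    moreover have "m (snd (g \<otimes>\<^bsub>G\<^esub> h) e) = m e" if "e \<in> word_arcs n \<sigma>" for e
      using that aut_arc[of h "fst e" "snd e"] g by (auto simp: label_group_def)
    ultimately show "g \<otimes>\<^bsub>G\<^esub> h \<in> label_group m" by (simp add: label_group_def)
  qed (auto simp: label_group_def)
qed

text \<open>An instance of uniqueness: the identity preserves labels too.\<close>

lemma label_group_fixed_point:
  assumes m: "labelling \<rho> m" and g: "g \<in> label_group m" and x: "red x" "fst g x = x"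
  shows "g = (id, id)"
proof (rule aut_eqI)
  show "g \<in> carrier G" using g by (simp add: label_group_def)
  show "(id, id) \<in> carrier G" using group.is_monoid[OF group_G] monoid.one_closed by fastforce
  have "preserves m id" by (simp add: preserves_def)
  then show "fst g y = fst (id, id) y" if "red y" for y
    using preserves_unique[OF m label_group_preserves[OF g], of id x y] that x by simp
qed

lemma label_group_to_root:
  assumes "labelling \<rho> m" "red y"
  obtains g where "g \<in> label_group m" "fst g y = []"
proof -
  interpret group G by (rule group_G)
  obtain h where h: "h \<in> label_group m" "fst h [] = y"
    using label_group_transitive_root[OF assms] by blast
  have "inv\<^bsub>G\<^esub> h \<in> label_group m" using subgroup.m_inv_closed[OF label_group_subgroup h(1)] .
  moreover have "inv\<^bsub>G\<^esub> h \<otimes>\<^bsub>G\<^esub> h = \<one>\<^bsub>G\<^esub>" using h(1) by (intro l_inv) (simp add: label_group_def)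
  then have "fst (inv\<^bsub>G\<^esub> h) y = []" using h(2) by (auto simp: fun_eq_iff)
  ultimately show thesis using that by blast
qed

lemma label_group_free:
  assumes m: "labelling \<rho> m"
  shows "acts_freely T bar (label_group m)"
  unfolding acts_freely_def
proof (intro ballI impI conjI)
  fix g assume g: "g \<in> label_group m" "g \<noteq> \<one>\<^bsub>G\<^esub>"
  then have no_fix: "fst g x \<noteq> x" if "red x" for x
    using label_group_fixed_point[OF m g(1) that] by auto
  then show "fst g x \<noteq> x" if "x \<in> verts T" for x using that by simp
  fix e assume "e \<in> arcs T"
  then have e: "e \<in> word_arcs n \<sigma>" by simp
  obtain u w where uw: "e = (u, w)" by (cases e)
  show "snd g e \<noteq> e"
    using aut_arc[of g u w] g(1) e uw no_fix[of u] arcs_red by (auto simp: label_group_def)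
  have "m (bar e) \<noteq> m e"
    using m e label_range[OF m e] unfolding labelling_def by metis
  then show "snd g e \<noteq> bar e" using g(1) e by (auto simp: label_group_def)
qed

lemma label_group_uniform_lattice:
  assumes m: "labelling \<rho> m"
  shows "uniform_lattice T bar (label_group m)"
  unfolding uniform_lattice_def
proof (intro conjI ballI)
  let ?A = "G\<lparr>carrier := label_group m\<rparr>"
  show "finite (stabilizer ?A fst x)" if "x \<in> verts T" for x
  proof (rule finite_subset)
    show "stabilizer ?A fst x \<subseteq> {(id, id)}"
      using label_group_fixed_point[OF m] that by (auto simp: stabilizer_def simp del: split_paired_All)
  qed simp
  have "orbit ?A fst x = verts T" if x: "red x" for x
  proof (intro equalityI subsetI)
    fix y assume "y \<in> orbit ?A fst x"
    then show "y \<in> verts T" using x aut_red by (auto simp: orbit_def label_group_def)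
  next
    fix y assume "y \<in> verts T"
    then have "red y" by simp
    then obtain h where h: "h \<in> label_group m" "fst h [] = y"
      using label_group_transitive_root[OF m] by blast
    obtain g where g: "g \<in> label_group m" "fst g x = []"
      using label_group_to_root[OF m x] by blast
    have "h \<otimes>\<^bsub>G\<^esub> g \<in> label_group m"
      using subgroup.m_closed[OF label_group_subgroup h(1) g(1)] .
    moreover have "y = fst (h \<otimes>\<^bsub>G\<^esub> g) x" using g h by simp
    moreover have "orbit ?A fst x = {fst g x |g. g \<in> label_group m}" by (simp add: orbit_def)
    ultimately show "y \<in> orbit ?A fst x" by blast
  qed
  then have "orbits ?A (verts T) fst \<subseteq> {verts T}" by (auto simp: orbits_def)
  then show "finite (orbits ?A (verts T) fst)" using finite_subset by blast
qed (rule label_group_subgroup)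

lemma local_action_apply:
  assumes "labelling \<rho> m" "red x" "e \<in> out_arcs T x"
  shows "local_action n T m g x (m e) = m (snd g e)"
proof -
  have "bij_betw m (out_arcs T x) {1..n}" using assms by (simp add: labelling_def)
  then show ?thesis using assms(3) bij_betw_inv_into_left bij_betwE
    unfolding local_action_def by fastforce
qed

lemma label_eq_imp_eq:
  assumes "labelling \<rho> m" "red x" "d \<in> out_arcs T x" "e \<in> out_arcs T x" "m d = m e"
  shows "d = e"
proof -
  have "d = (x, snd d)" "e = (x, snd e)" using assms(3,4) by (auto simp: out_arcs_iff prod_eq_iff)
  then show ?thesis
    using arc_unique[OF assms(1), of x "snd d" "snd e"] assms(3-5) by (metis out_arcs_iff)
qed

lemma label_surj:
  assumes "labelling \<rho> m" "red x" "a \<in> {1..n}"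
  obtains e where "e \<in> out_arcs T x" "m e = a"
  using arc_exists[OF assms] by (metis fst_conv out_arcs_iff)

lemma aut_out_arcs:
  assumes "g \<in> carrier G" "e \<in> out_arcs T x"
  shows "snd g e \<in> out_arcs T (fst g x)"
  using assms aut_arc[of g "fst e" "snd e"] by (auto simp: out_arcs_iff)

end

section \<open>Labellings related by a permutation group\<close>

locale word_tree_with_group = word_tree_labels +
  fixes F :: "(nat \<Rightarrow> nat) set"
  assumes F_subgroup: "subgroup F (sym_group n)"
begin

abbreviation "U \<equiv> universal_group n F T bar lab"

lemma F_permutes: "f \<in> F \<Longrightarrow> f permutes {1..n}"
  using subgroup.subset[OF F_subgroup] sym_group_carrier by blast

lemma F_comp: "f \<in> F \<Longrightarrow> g \<in> F \<Longrightarrow> f \<circ> g \<in> F"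
  using subgroup.m_closed[OF F_subgroup] by (simp add: sym_group_mult)

lemma F_id: "id \<in> F"
  using subgroup.one_closed[OF F_subgroup] by (simp add: sym_group_one)

lemma F_inv: "f \<in> F \<Longrightarrow> inv' f \<in> F"
  using subgroup.m_inv_closed[OF F_subgroup] subgroup.subset[OF F_subgroup]
  by (metis subsetD sym_group_inv_equality)

lemma F_inv_inverse: "f \<in> F \<Longrightarrow> inv' f (f a) = a" "f \<in> F \<Longrightarrow> f (inv' f a) = a"
  using permutes_inverses[OF F_permutes] by auto

definition related :: "(nat list \<times> nat list \<Rightarrow> nat) \<Rightarrow> (nat list \<times> nat list \<Rightarrow> nat) \<Rightarrow> bool" where
  "related m m' \<longleftrightarrow> (\<forall>x. red x \<longrightarrow> (\<exists>f\<in>F. \<forall>e\<in>out_arcs T x. m e = f (m' e)))"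

lemma related_sym: "related m m' \<Longrightarrow> related m' m"
  unfolding related_def using F_inv F_inv_inverse by metis

lemma related_trans: "related m m' \<Longrightarrow> related m' m'' \<Longrightarrow> related m m''"
  unfolding related_def using F_comp by (metis comp_apply)

lemma related_lab: "related lab lab"
  unfolding related_def using F_id by (metis id_apply)

text \<open>
  Membership in the universal group says that \<open>g\<close> pulls the labelling back to a related one. In this
  form it behaves well under composition and under a change of labelling.
\<close>

lemma mem_universal:
  assumes m: "labelling \<rho> m" and g: "g \<in> carrier G"
  shows "g \<in> universal_group n F T bar m \<longleftrightarrow> related (m \<circ> snd g) m"
proof
  assume "g \<in> universal_group n F T bar m"
  then have "local_action n T m g x \<in> F" if "red x" for x
    using that by (simp add: universal_group_def)
  then show "related (m \<circ> snd g) m"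
    unfolding related_def using local_action_apply[OF m] by (metis comp_apply)
next
  assume r: "related (m \<circ> snd g) m"
  have "local_action n T m g x \<in> F" if x: "red x" for x
  proof -
    obtain f where f: "f \<in> F" "\<And>e. e \<in> out_arcs T x \<Longrightarrow> m (snd g e) = f (m e)"
      using r x by (auto simp: related_def)
    have "local_action n T m g x i = f i" for i
    proof (cases "i \<in> {1..n}")
      case True
      then obtain e where "e \<in> out_arcs T x" "m e = i" using label_surj[OF m x] by blast
      then show ?thesis using local_action_apply[OF m x, of e g] f(2)[of e] by simp
    next
      case False
      then show ?thesis using permutes_not_in[OF F_permutes[OF f(1)]]
        by (auto simp: local_action_def)
    qed
    then show ?thesis using f(1) by (metis ext)
  qed
  then show "g \<in> universal_group n F T bar m" using g by (simp add: universal_group_def)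
qed

lemma related_comp:
  assumes "g \<in> carrier G" "related m m'"
  shows "related (m \<circ> snd g) (m' \<circ> snd g)"
  using assms aut_red aut_out_arcs unfolding related_def comp_apply by metis

lemma universal_related:
  assumes "labelling \<rho> m" "labelling \<rho>' m'" "related m m'"
  shows "universal_group n F T bar m = universal_group n F T bar m'"
proof -
  have "g \<in> universal_group n F T bar m \<longleftrightarrow> g \<in> universal_group n F T bar m'"
    if "g \<in> carrier G" for g
    unfolding mem_universal[OF assms(1) that] mem_universal[OF assms(2) that]
    using related_comp[OF that assms(3)] assms(3) related_trans related_sym by metis
  then show ?thesis by (auto simp: universal_group_def)
qed

lemma label_group_universal:
  assumes m: "labelling \<rho> m" "related m lab"
  shows "label_group m \<subseteq> U"
proof
  fix g assume g: "g \<in> label_group m"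
  have "related (m \<circ> snd g) m"
    using g F_id unfolding related_def label_group_def out_arcs_iff by (auto intro!: bexI[of _ id])
  then have "g \<in> universal_group n F T bar m"
    using mem_universal[OF m(1)] g by (auto simp: label_group_def)
  then show "g \<in> U" using universal_related[OF m(1) labelling_lab m(2)] by simp
qed

text \<open>
  Conjugating a label group by \<open>u\<close> amounts to translating the labelling by \<open>u\<close>, and a translate by an
  element of the universal group stays related to the original. Thus conjugates of
  label groups can be treated as label groups.
\<close>

lemma conjugate_labelling:
  assumes m: "labelling \<rho> m" "related m lab" and u: "u \<in> U"
  shows "\<exists>m'. labelling \<rho> m' \<and> related m' lab \<and> label_group m' \<subseteq> conjugate G u (label_group m)"
proof -
  interpret group G by (rule group_G)
  define v where "v = inv\<^bsub>G\<^esub> u"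
  have uc: "u \<in> carrier G" using u by (simp add: universal_group_def)
  then have vc: "v \<in> carrier G" by (simp add: v_def)
  have "u \<otimes>\<^bsub>G\<^esub> v = (id, id)" "v \<otimes>\<^bsub>G\<^esub> u = (id, id)"
    using r_inv[OF uc] l_inv[OF uc] by (simp_all add: v_def)
  then have "snd u \<circ> snd v = id" "snd v \<circ> snd u = id" "fst u \<circ> fst v = id" "fst v \<circ> fst u = id"
    by simp_all
  then have uv: "snd u (snd v e) = e" "snd v (snd u e) = e" "fst u (fst v x) = x" "fst v (fst u x) = x" for e x
    by (metis comp_apply id_apply)+
  define m' where "m' = m \<circ> snd v"
  have "labelling \<rho> m'"
    unfolding labelling_def
  proof (intro conjI allI impI ballI)
    fix x assume x: "red x"
    have "bij_betw (snd v) (out_arcs T x) (out_arcs T (fst v x))"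
      using aut_out_arcs[OF vc] aut_out_arcs[OF uc, of _ "fst v x"] uv
      by (intro bij_betw_byWitness[where f' = "snd u"]) auto
    moreover have "bij_betw m (out_arcs T (fst v x)) {1..n}"
      using m(1) aut_red[OF vc] x by (simp add: labelling_def)
    ultimately show "bij_betw m' (out_arcs T x) {1..n}"
      unfolding m'_def by (rule bij_betw_trans)
  next
    fix e assume e: "e \<in> word_arcs n \<sigma>"
    have "snd v e \<in> word_arcs n \<sigma>" using aut_arc[OF vc, of "fst e" "snd e"] e by simp
    moreover have "snd v (bar e) = bar (snd v e)" using vc e by (simp add: aut_group_def)
    ultimately show "m' (bar e) = \<rho> (m' e)" using m(1) by (simp add: m'_def labelling_def)
  next
    show "\<rho> a \<noteq> a" if "a \<in> {1..n}" for a using m(1) that by (simp add: labelling_def)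
  qed
  moreover have "related m' lab"
  proof -
    have "related (lab \<circ> snd u) lab" using u mem_universal[OF labelling_lab uc] by simp
    from related_comp[OF vc this] have "related lab (lab \<circ> snd v)" using uv by (simp add: comp_def)
    then show ?thesis
      using related_comp[OF vc m(2)] related_trans related_sym unfolding m'_def by metis
  qed
  moreover have "label_group m' \<subseteq> conjugate G u (label_group m)"
  proof
    fix g assume g: "g \<in> label_group m'"
    then have gc: "g \<in> carrier G" by (simp add: label_group_def)
    define h where "h = v \<otimes>\<^bsub>G\<^esub> g \<otimes>\<^bsub>G\<^esub> u"
    have "h \<in> carrier G" using gc uc vc unfolding h_def by (intro m_closed)
    moreover have "m (snd h e) = m e" if "e \<in> word_arcs n \<sigma>" for e
    proof -
      have "m (snd h e) = m' (snd g (snd u e))" by (simp add: h_def m'_def)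
      also have "\<dots> = m' (snd u e)"
        using g aut_arc[OF uc, of "fst e" "snd e"] that by (simp add: label_group_def)
      finally show ?thesis by (simp add: m'_def uv)
    qed
    ultimately have "h \<in> label_group m" by (simp add: label_group_def)
    moreover have "g = u \<otimes>\<^bsub>G\<^esub> h \<otimes>\<^bsub>G\<^esub> inv\<^bsub>G\<^esub> u"
      unfolding v_def[symmetric] by (simp add: h_def prod_eq_iff fun_eq_iff uv)
    ultimately show "g \<in> conjugate G u (label_group m)"
      unfolding conjugate_def l_coset_def r_coset_def by blast
  qed
  ultimately show ?thesis by blast
qed

section \<open>The obstruction to a common lattice\<close>

text \<open>
  Local actions at the root are computed in the labelling \<open>m1\<close>; the hypotheses \<open>comm\<close> and \<open>fix_comm\<close>
  say that the stabiliser of \<open>a0\<close> in \<open>F\<close> is abelian and that the derived subgroup of \<open>F\<close> fixes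
  \<open>\<sigma> a0\<close>. The first gives \<open>derived G (stab a0) \<subseteq> K\<close> and the second \<open>derived G S \<subseteq> stab (\<sigma> a0)\<close>. As
  \<open>stab (\<sigma> a0)\<close> is conjugate into \<open>stab a0\<close>, its derived series ends inside \<open>K\<close>, and so does that of
  \<open>S\<close>. Hence the local action \<open>\<theta> ` S\<close> is soluble, against \<open>insoluble\<close>.
\<close>

lemma no_common_lattice:
  assumes m1: "labelling \<sigma> m1" "related m1 lab" and m2: "labelling \<rho> m2" "related m2 lab"
    and \<Lambda>: "uniform_lattice T bar \<Lambda>" "\<Lambda> \<subseteq> U" "label_group m1 \<subseteq> \<Lambda>" "label_group m2 \<subseteq> \<Lambda>"
    and a0: "a0 \<in> {1..n}"
    and comm: "\<forall>f\<in>F. \<forall>g\<in>F. f a0 = a0 \<and> g a0 = a0 \<longrightarrow> f \<circ> g \<circ> inv' f \<circ> inv' g = id"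
    and fix_comm: "\<forall>f\<in>F. \<forall>g\<in>F. (f \<circ> g \<circ> inv' f \<circ> inv' g) (\<sigma> a0) = \<sigma> a0"
    and insoluble: "\<forall>A f k. subgroup A (sym_group n) \<and> A \<subseteq> F \<and> f \<in> F \<and>
        (\<forall>b\<in>{1..n}. \<exists>\<alpha>\<in>A. f (\<alpha> (\<sigma> b)) = \<rho> (f b)) \<longrightarrow>
        \<not> (derived (sym_group n) ^^ k) A \<subseteq> {id}"
  shows False
proof -
  interpret G: group G by (rule group_G)
  have \<Lambda>_sub: "subgroup \<Lambda> G" using \<Lambda>(1) by (simp add: uniform_lattice_def)
  note \<Lambda>_m = subgroup.m_closed[OF \<Lambda>_sub] and \<Lambda>_inv = subgroup.m_inv_closed[OF \<Lambda>_sub]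
    and \<Lambda>_G = subgroup.mem_carrier[OF \<Lambda>_sub]
  have inv_fst: "fst (inv\<^bsub>G\<^esub> g) (fst g x) = x" "snd (inv\<^bsub>G\<^esub> g) (snd g e) = e"
    if "g \<in> carrier G" for g x e
    using G.l_inv[OF that] by (auto simp: fun_eq_iff simp del: split_paired_All) 
  have inv_fst': "fst (inv\<^bsub>G\<^esub> g) y = x" if "g \<in> carrier G" "fst g x = y" for g x y
    using inv_fst[OF that(1)] that(2) by blast
  define S where "S = {g \<in> \<Lambda>. fst g [] = []}"
  have S_stab: "S = stabilizer (G\<lparr>carrier := \<Lambda>\<rparr>) fst []" by (auto simp: S_def stabilizer_def)
  have S_fin: "finite S" using \<Lambda>(1) unfolding S_stab uniform_lattice_def by simp
  have S_sub: "subgroup S G"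
  proof (rule G.subgroupI)
    show "S \<noteq> {}" using subgroup.one_closed[OF \<Lambda>_sub] by (auto simp: S_def)
  qed (use \<Lambda>_m \<Lambda>_inv \<Lambda>_G inv_fst' in \<open>auto simp: S_def simp del: split_paired_All\<close>)
  define \<theta> where "\<theta> g = local_action n T m1 g []" for g
  define R where "R = out_arcs T []"
  have \<theta>: "\<theta> g (m1 e) = m1 (snd g e)" if "e \<in> R" for g e
    using local_action_apply[OF m1(1) _ that[unfolded R_def]] by (simp add: \<theta>_def)
  have U_eq: "universal_group n F T bar m1 = U"
    by (rule universal_related[OF m1(1) labelling_lab m1(2)])
  have \<theta>_F: "\<theta> g \<in> F" if "g \<in> S" for g
  proof -
    have "g \<in> universal_group n F T bar m1" using that \<Lambda>(2) U_eq by (auto simp: S_def)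
    then show ?thesis by (simp add: \<theta>_def universal_group_def)
  qed
  have S_R: "snd g e \<in> R" if "g \<in> S" "e \<in> R" for g e
    using aut_out_arcs[of g e "[]"] that \<Lambda>_G by (simp add: S_def R_def)
  have \<theta>_mult: "\<theta> (g \<otimes>\<^bsub>G\<^esub> h) = \<theta> g \<circ> \<theta> h" if "g \<in> S" "h \<in> S" for g h
  proof
    fix i
    show "\<theta> (g \<otimes>\<^bsub>G\<^esub> h) i = (\<theta> g \<circ> \<theta> h) i"
    proof (cases "i \<in> {1..n}")
      case True
      then obtain e where e: "e \<in> R" "i = m1 e" 
        using label_surj[OF m1(1) _ True] reduced.simps(1) unfolding R_def by metis
      show ?thesis
        unfolding e(2) comp_apply \<theta>[OF e(1)] \<theta>[OF S_R[OF that(2) e(1)]] by simp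
    next
      case False
      then show ?thesis by (auto simp: \<theta>_def local_action_def)
    qed
  qed
  let ?GS = "G\<lparr>carrier := S\<rparr>"
  have GS: "group ?GS" by (rule G.subgroup_imp_group[OF S_sub])
  interpret \<theta>: group_hom ?GS "sym_group n" \<theta>
  proof (intro group_hom.intro group_hom_axioms.intro)
    show "\<theta> \<in> hom ?GS (sym_group n)"
      using \<theta>_F F_permutes \<theta>_mult by (auto simp: hom_def sym_group_carrier sym_group_mult simp del: G_simps)
  qed (rule GS sym_group_is_group)+
  have \<theta>_inv: "\<theta> (inv\<^bsub>G\<^esub> g) = inv' (\<theta> g)" if "g \<in> S" for g
  proof -
    have "\<theta> (inv\<^bsub>?GS\<^esub> g) = inv\<^bsub>sym_group n\<^esub> (\<theta> g)" using that by (intro \<theta>.hom_inv) simp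
    then show ?thesis
      using that G.m_inv_consistent[OF S_sub that] \<theta>_F F_permutes sym_group_carrier by simp
  qed
  note S_m = subgroup.m_closed[OF S_sub] and S_inv = subgroup.m_inv_closed[OF S_sub]
    and S_G = subgroup.mem_carrier[OF S_sub]
  have \<theta>_comm: "\<theta> (g \<otimes>\<^bsub>G\<^esub> h \<otimes>\<^bsub>G\<^esub> inv\<^bsub>G\<^esub> g \<otimes>\<^bsub>G\<^esub> inv\<^bsub>G\<^esub> h) =
      \<theta> g \<circ> \<theta> h \<circ> inv' (\<theta> g) \<circ> inv' (\<theta> h)" if "g \<in> S" "h \<in> S" for g h
    using that by (simp only: \<theta>_mult \<theta>_inv S_m S_inv)
  have S_comm: "g \<otimes>\<^bsub>G\<^esub> h \<otimes>\<^bsub>G\<^esub> inv\<^bsub>G\<^esub> g \<otimes>\<^bsub>G\<^esub> inv\<^bsub>G\<^esub> h \<in> S" if "g \<in> S" "h \<in> S" for g h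
    using that by (intro S_m S_inv)

  define stab where "stab a = {g \<in> S. \<theta> g a = a}" for a
  have stab_sub: "subgroup (stab a) G" for a
  proof (rule G.subgroupI)
    show "stab a \<subseteq> carrier G" using S_G by (auto simp: stab_def)
    have "(id, id) \<in> stab a"
      using \<theta>.hom_one subgroup.one_closed[OF S_sub] by (simp add: stab_def sym_group_one)
    then show "stab a \<noteq> {}" by blast
    fix g assume g: "g \<in> stab a"
    then show "inv\<^bsub>G\<^esub> g \<in> stab a"
      using S_inv \<theta>_inv F_inv_inverse(1)[OF \<theta>_F, of g a] by (auto simp: stab_def)
    fix h assume "h \<in> stab a"
    then show "g \<otimes>\<^bsub>G\<^esub> h \<in> stab a" using g S_m \<theta>_mult by (auto simp: stab_def simp del: G_simps)
  qed
  define K where "K = {g \<in> S. \<theta> g = id}"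
  have K_sub: "subgroup K G"
  proof (rule G.subgroupI)
    show "K \<subseteq> carrier G" using S_G by (auto simp: K_def)
    have "(id, id) \<in> K"
      using \<theta>.hom_one subgroup.one_closed[OF S_sub] by (simp add: K_def sym_group_one)
    then show "K \<noteq> {}" by blast
    fix g assume g: "g \<in> K"
    then show "inv\<^bsub>G\<^esub> g \<in> K" using S_inv \<theta>_inv by (auto simp: K_def)
    fix h assume "h \<in> K"
    then show "g \<otimes>\<^bsub>G\<^esub> h \<in> K" using g S_m \<theta>_mult by (auto simp: K_def simp del: G_simps)
  qed

  have D1: "derived G (stab a0) \<subseteq> K"
    unfolding derived_def
  proof (rule G.generate_subgroup_incl[OF _ K_sub])
    show "derived_set G (stab a0) \<subseteq> K"
    proof
      fix x assume "x \<in> derived_set G (stab a0)"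
      then obtain g h where gh: "g \<in> stab a0" "h \<in> stab a0"
        and x: "x = g \<otimes>\<^bsub>G\<^esub> h \<otimes>\<^bsub>G\<^esub> inv\<^bsub>G\<^esub> g \<otimes>\<^bsub>G\<^esub> inv\<^bsub>G\<^esub> h" by blast
      have S: "g \<in> S" "h \<in> S" "\<theta> g a0 = a0" "\<theta> h a0 = a0" using gh by (simp_all add: stab_def)
      then have "\<theta> x = id" unfolding x \<theta>_comm[OF S(1,2)] using comm \<theta>_F by blast
      then show "x \<in> K" using S_comm[OF S(1,2)] x unfolding K_def by blast
    qed
  qed
  have D2: "derived G S \<subseteq> stab (\<sigma> a0)"
    unfolding derived_def
  proof (rule G.generate_subgroup_incl[OF _ stab_sub])
    show "derived_set G S \<subseteq> stab (\<sigma> a0)"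
    proof
      fix x assume "x \<in> derived_set G S"
      then obtain g h where S: "g \<in> S" "h \<in> S"
        and x: "x = g \<otimes>\<^bsub>G\<^esub> h \<otimes>\<^bsub>G\<^esub> inv\<^bsub>G\<^esub> g \<otimes>\<^bsub>G\<^esub> inv\<^bsub>G\<^esub> h" by blast
      have "\<theta> x (\<sigma> a0) = \<sigma> a0" unfolding x \<theta>_comm[OF S] using fix_comm \<theta>_F S by blast
      then show "x \<in> stab (\<sigma> a0)" using S_comm[OF S] x unfolding stab_def by blast
    qed
  qed

  \<comment> \<open>The element \<open>\<gamma>\<close> turns the arc \<open>e1\<close> with label \<open>a0\<close> round: it moves its far end \<open>y\<close> to the root,
    so that the inverse of \<open>e1\<close> becomes the arc \<open>e2\<close> at the root with label \<open>\<sigma> a0\<close>.\<close>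
  obtain e1 where e1: "e1 \<in> R" "m1 e1 = a0" using label_surj[OF m1(1) _ a0, of "[]"] by (auto simp: R_def)
  define y where "y = snd e1"
  have y: "e1 = ([], y)" "([], y) \<in> word_arcs n \<sigma>" "red y"
    using out_arcs_pair[OF e1(1)[unfolded R_def]] unfolding y_def by blast+
  obtain \<gamma> where \<gamma>: "\<gamma> \<in> label_group m1" "fst \<gamma> y = []"
    using label_group_to_root[OF m1(1) y(3)] by blast
  have \<gamma>_G: "\<gamma> \<in> carrier G" and \<gamma>_\<Lambda>: "\<gamma> \<in> \<Lambda>" using \<gamma>(1) \<Lambda>(3) by (auto simp: label_group_def)
  define e2 where "e2 = snd \<gamma> (bar e1)"
  have be1: "bar e1 = (y, [])" "(y, []) \<in> word_arcs n \<sigma>" using y bar_arc arcs_sym by auto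
  have e2: "e2 \<in> R" "e2 = ([], fst \<gamma> [])"
    using aut_arc[OF \<gamma>_G be1(2)] \<gamma>(2) by (auto simp: e2_def be1 R_def out_arcs_iff)
  have "m1 (bar e1) = \<sigma> a0"
    using m1(1) y(1,2) e1(2) unfolding labelling_def by blast
  moreover have "m1 e2 = m1 (bar e1)"
    using \<gamma>(1) be1 unfolding e2_def label_group_def by simp
  ultimately have m1_e2: "m1 e2 = \<sigma> a0" by simp
  define c where "c x = \<gamma> \<otimes>\<^bsub>G\<^esub> x \<otimes>\<^bsub>G\<^esub> inv\<^bsub>G\<^esub> \<gamma>" for x
  have c_hom: "group_hom G G c"
  proof
    show "c \<in> hom G G"
      using \<gamma>_G unfolding hom_def c_def by (auto simp: G.m_assoc G.inv_solve_left simp del: G_simps)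
  qed
  have conj: "stab (\<sigma> a0) \<subseteq> c ` stab a0"
  proof
    fix g assume g: "g \<in> stab (\<sigma> a0)"
    then have gS: "g \<in> S" and gG: "g \<in> carrier G" and g\<Lambda>: "g \<in> \<Lambda>"
      using S_G by (auto simp: stab_def S_def)
    have "\<theta> g (\<sigma> a0) = \<sigma> a0" using g by (simp add: stab_def)
    then have "m1 (snd g e2) = m1 e2" using \<theta>[OF e2(1), of g] by (simp only: m1_e2)
    then have "snd g e2 = e2"
      using label_eq_imp_eq[OF m1(1) _ S_R[OF gS e2(1), unfolded R_def] e2(1)[unfolded R_def]]
      by (simp only: reduced.simps)
    then have fg: "fst g (fst \<gamma> []) = fst \<gamma> []"
      using aut_arc[OF gG, of "[]" "fst \<gamma> []"] e2 by (simp add: R_def out_arcs_iff)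
    define x where "x = inv\<^bsub>G\<^esub> \<gamma> \<otimes>\<^bsub>G\<^esub> g \<otimes>\<^bsub>G\<^esub> \<gamma>"
    have x\<Lambda>: "x \<in> \<Lambda>" using \<gamma>_\<Lambda> g\<Lambda> unfolding x_def by (intro \<Lambda>_m \<Lambda>_inv)
    have "fst x [] = []" using fg inv_fst[OF \<gamma>_G] by (simp add: x_def)
    then have xS: "x \<in> S" using x\<Lambda> by (simp add: S_def)
    have "fst g [] = []" using gS by (simp add: S_def)
    then have "fst x y = y" using \<gamma>(2) inv_fst(1)[OF \<gamma>_G, of y] by (simp add: x_def)
    then have "snd x e1 = e1" using aut_arc[OF \<Lambda>_G[OF x\<Lambda>] y(2)] y(1) \<open>fst x [] = []\<close> by simp
    then have "x \<in> stab a0" using xS \<theta>[OF e1(1), of x] e1(2) by (simp add: stab_def)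
    moreover have "g = c x"
      using gG \<gamma>_G G.m_assoc[of \<gamma> "inv\<^bsub>G\<^esub> \<gamma>" g, symmetric] unfolding c_def x_def
      by (simp add: G.m_assoc del: G_simps)
    ultimately show "g \<in> c ` stab a0" by blast
  qed
  have "finite (stab a0)" using S_fin by (simp add: stab_def)
  moreover have "K \<subseteq> stab (\<sigma> a0)" by (auto simp: K_def stab_def)
  ultimately obtain k where k: "(derived G ^^ k) (stab (\<sigma> a0)) \<subseteq> K"
    using G.derived_series_eventually_below[OF c_hom stab_sub _ stab_sub K_sub D1 _ conj] by blast
  have "(derived (sym_group n) ^^ Suc k) (\<theta> ` S) = \<theta> ` ((derived ?GS ^^ Suc k) S)"
    by (rule \<theta>.exp_of_derived_img) simp
  also have "(derived ?GS ^^ Suc k) S = (derived G ^^ Suc k) S"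
    by (rule G.exp_of_derived_consistent[OF S_sub order_refl])
  also have "\<dots> = (derived G ^^ k) (derived G S)" by (simp add: funpow_swap1)
  also have "\<theta> ` \<dots> \<subseteq> \<theta> ` K"
    by (rule image_mono) (use G.mono_exp_of_derived[OF D2] k in blast)
  also have "\<dots> \<subseteq> {id}" by (auto simp: K_def)
  finally have solv: "(derived (sym_group n) ^^ Suc k) (\<theta> ` S) \<subseteq> {id}" .

  \<comment> \<open>At the root, \<open>f\<close> translates from \<open>m1\<close>-labels to \<open>m2\<close>-labels. The arc \<open>e\<close> with \<open>m1\<close>-label \<open>b\<close> is
    turned round by \<open>g1\<close> preserving \<open>m1\<close> and by \<open>g2\<close> preserving \<open>m2\<close>. Then \<open>g2 g1\<^sup>-\<^sup>1\<close> fixes the root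
    and takes the arc with \<open>m1\<close>-label \<open>\<sigma> b\<close> to the one with \<open>m2\<close>-label \<open>\<rho> (f b)\<close>.\<close>
  obtain f where f: "f \<in> F" "\<And>e. e \<in> R \<Longrightarrow> m2 e = f (m1 e)"
    using related_trans[OF m2(2) related_sym[OF m1(2)]] unfolding related_def R_def by force
  have forced: "\<exists>\<alpha>\<in>\<theta> ` S. f (\<alpha> (\<sigma> b)) = \<rho> (f b)" if b: "b \<in> {1..n}" for b
  proof -
    obtain e where e: "e \<in> R" "m1 e = b" using label_surj[OF m1(1) _ b, of "[]"] by (auto simp: R_def)
    define z where "z = snd e"
    have z: "e = ([], z)" "([], z) \<in> word_arcs n \<sigma>" "red z"
      using out_arcs_pair[OF e(1)[unfolded R_def]] unfolding z_def by blast+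
    have be: "bar e = (z, [])" "(z, []) \<in> word_arcs n \<sigma>" using z bar_arc arcs_sym by auto
    have labels: "m1 (bar e) = \<sigma> b" "m2 (bar e) = \<rho> (f b)"
      using m1(1) m2(1) z e f(2)[OF e(1)] by (auto simp: labelling_def)
    obtain g1 where g1: "g1 \<in> label_group m1" "fst g1 z = []"
      using label_group_to_root[OF m1(1) z(3)] by blast
    obtain g2 where g2: "g2 \<in> label_group m2" "fst g2 z = []"
      using label_group_to_root[OF m2(1) z(3)] by blast
    have g1G: "g1 \<in> carrier G" and g2G: "g2 \<in> carrier G" using g1 g2 by (auto simp: label_group_def)
    define h where "h = g2 \<otimes>\<^bsub>G\<^esub> inv\<^bsub>G\<^esub> g1"
    have "h \<in> \<Lambda>" using g1 g2 \<Lambda>(3,4) \<Lambda>_m \<Lambda>_inv unfolding h_def by blast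
    moreover have "fst h [] = []" using inv_fst'[OF g1G g1(2)] g2(2) by (simp add: h_def)
    ultimately have hS: "h \<in> S" by (simp add: S_def)
    let ?d = "snd g1 (bar e)"
    have d: "?d \<in> R" using aut_arc[OF g1G be(2)] g1(2) by (auto simp: be R_def out_arcs_iff)
    have hd: "snd h ?d = snd g2 (bar e)" using inv_fst(2)[OF g1G] by (simp add: h_def)
    have "m1 ?d = \<sigma> b" "m2 (snd g2 (bar e)) = \<rho> (f b)"
      using g1(1) g2(1) be labels by (auto simp: label_group_def)
    then have "f (\<theta> h (\<sigma> b)) = \<rho> (f b)"
      using \<theta>[OF d, of h] f(2)[OF S_R[OF hS d]] hd by simp
    then show ?thesis using hS by blast
  qed
  have "subgroup (\<theta> ` S) (sym_group n)"
    using \<theta>.subgroup_img_is_subgroup[of S] group.subgroup_self[OF GS] by simp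
  moreover have "\<theta> ` S \<subseteq> F" using \<theta>_F by blast
  moreover have "\<forall>b\<in>{1..n}. \<exists>\<alpha>\<in>\<theta> ` S. f (\<alpha> (\<sigma> b)) = \<rho> (f b)" using forced by blast
  ultimately show False using insoluble f(1) solv by blast
qed

section \<open>Two incompatible lattices\<close>

text \<open>
  The permutation by which the twisted labelling differs from \<open>word_lab\<close> at the vertex \<open>w\<close>. At each
  step away from the root it only has to take one prescribed label to another in the same orbit.
\<close>

primrec twist :: "(nat \<Rightarrow> nat) \<Rightarrow> nat list \<Rightarrow> nat \<Rightarrow> nat" where
  "twist \<rho> [] = id"
| "twist \<rho> (a # w) = (SOME f. f \<in> F \<and> f (\<sigma> a) = \<rho> (twist \<rho> w a))"

lemma related_labelling_exists:
  assumes \<sigma>_orbit: "\<forall>f\<in>F. \<forall>a\<in>{1..n}. \<exists>f'\<in>F. \<sigma> (f a) = f' (\<sigma> a)"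
    and \<rho>_orbit: "\<forall>a\<in>{1..n}. \<exists>f\<in>F. \<rho> a = f (\<sigma> a)"
    and \<rho>: "\<forall>a\<in>{1..n}. \<rho> (\<rho> a) = a \<and> \<rho> a \<noteq> a"
  shows "\<exists>m. labelling \<rho> m \<and> related m lab"
proof -
  have ex: "\<exists>g. g \<in> F \<and> g (\<sigma> a) = \<rho> (f a)" if f: "f \<in> F" and a: "a \<in> {1..n}" for f a
  proof -
    have "f a \<in> {1..n}" using permutes_in_image[OF F_permutes[OF f]] a by blast
    then obtain f1 where f1: "f1 \<in> F" "\<rho> (f a) = f1 (\<sigma> (f a))" using \<rho>_orbit by blast
    obtain f2 where f2: "f2 \<in> F" "\<sigma> (f a) = f2 (\<sigma> a)" using \<sigma>_orbit f a by blast
    show ?thesis using F_comp[OF f1(1) f2(1)] f1(2) f2(2) by (intro exI[of _ "f1 \<circ> f2"]) simp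
  qed
  have twist_step: "twist \<rho> (a # w) \<in> F \<and> twist \<rho> (a # w) (\<sigma> a) = \<rho> (twist \<rho> w a)"
    if "twist \<rho> w \<in> F" "a \<in> {1..n}" for a w
    unfolding twist.simps by (rule someI_ex[OF ex[OF that]])
  have twist_F: "twist \<rho> w \<in> F" if "red w" for w
    using that by (induction w) (use F_id twist_step reduced_Cons in auto)
  define m where "m e = twist \<rho> (fst e) (lab e)" for e
  have "related m lab"
    unfolding related_def m_def
  proof (intro allI impI)
    fix x assume "red x"
    then show "\<exists>f\<in>F. \<forall>e\<in>out_arcs T x. twist \<rho> (fst e) (lab e) = f (lab e)"
      using twist_F by (intro bexI[of _ "twist \<rho> x"]) (auto simp: out_arcs_iff)
  qed
  moreover have "labelling \<rho> m"
    unfolding labelling_def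
  proof (intro conjI allI impI ballI)
    fix x assume x: "red x"
    have "bij_betw (twist \<rho> x) {1..n} {1..n}"
      using F_permutes[OF twist_F[OF x]] by (rule permutes_imp_bij)
    then have "bij_betw (twist \<rho> x \<circ> lab) (out_arcs T x) {1..n}"
      using bij_betw_trans[OF lab_bij[OF x]] by blast
    then show "bij_betw m (out_arcs T x) {1..n}"
      by (rule bij_betw_cong[THEN iffD1, rotated]) (auto simp: m_def out_arcs_iff)
  next
    fix e assume e: "e \<in> word_arcs n \<sigma>"
    obtain u w where uw: "e = (u, w)" by (cases e)
    have step: "m (v, b # v) = twist \<rho> v b \<and> m (b # v, v) = \<rho> (twist \<rho> v b) \<and> twist \<rho> v b \<in> {1..n}"
      if "red (b # v)" for b v
    proof -
      have b: "b \<in> {1..n}" and v: "twist \<rho> v \<in> F" using that twist_F reduced_Cons by blast+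
      then show ?thesis
        using twist_step[OF v b] permutes_in_image[OF F_permutes[OF v]]
        by (simp add: m_def word_lab_def del: twist.simps)
    qed
    consider b where "w = b # u" "red (b # u)" | b where "u = b # w" "red (b # w)"
      using e uw by (auto simp: word_arcs_def)
    then show "m (bar e) = \<rho> (m e)"
    proof cases
      case 1
      then show ?thesis using step[of b u] e by (simp add: uw bar_arc)
    next
      case 2
      then show ?thesis using step[of b w] e \<rho> by (simp add: uw bar_arc)
    qed
  qed (use \<rho> in blast)
  ultimately show ?thesis by blast
qed

lemma perm_orbits_eq: "perm_orbits n F = (\<lambda>a. {f a |f. f \<in> F}) ` {1..n}"
  by (auto simp: perm_orbits_def orbits_def orbit_def)

text \<open>Thus \<open>\<sigma>\<close> induces an involution of the set of orbits, which serves as the involution \<open>\<tau>\<close>.\<close>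

lemma involution_image_orbit:
  assumes \<sigma>_orbit: "\<forall>f\<in>F. \<forall>a\<in>{1..n}. \<exists>f'\<in>F. \<sigma> (f a) = f' (\<sigma> a)"
    and a: "a \<in> {1..n}"
  shows "\<sigma> ` {f a |f. f \<in> F} = {f (\<sigma> a) |f. f \<in> F}"
proof (intro equalityI subsetI)
  fix b assume "b \<in> {f (\<sigma> a) |f. f \<in> F}"
  then obtain f where f: "f \<in> F" "b = f (\<sigma> a)" by blast
  have "f (\<sigma> a) \<in> {1..n}" using permutes_in_image[OF F_permutes[OF f(1)]] \<sigma>_in[OF a] by blast
  then have "b = \<sigma> (\<sigma> (f (\<sigma> a)))" using f(2) \<sigma>_\<sigma> by simp
  moreover obtain f' where "f' \<in> F" "\<sigma> (f (\<sigma> a)) = f' a"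
    using \<sigma>_orbit f(1) \<sigma>_in[OF a] \<sigma>_\<sigma>[OF a] by metis
  ultimately show "b \<in> \<sigma> ` {f a |f. f \<in> F}" by blast
qed (use \<sigma>_orbit a in blast)

lemma orbit_involution_image:
  assumes \<sigma>_orbit: "\<forall>f\<in>F. \<forall>a\<in>{1..n}. \<exists>f'\<in>F. \<sigma> (f a) = f' (\<sigma> a)"
  shows "orbit_involution n F ((`) \<sigma>)"
  unfolding orbit_involution_def perm_orbits_eq
  using involution_image_orbit[OF \<sigma>_orbit] \<sigma>_in \<sigma>_\<sigma> by (auto simp del: atLeastAtMost_iff One_nat_def)

lemma legal_lab: "legal_labelling n F ((`) \<sigma>) T bar lab"
  using lab_bij lab_bar by (auto simp: legal_labelling_def)

theorem incompatible_lattices: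
  assumes \<sigma>_orbit: "\<forall>f\<in>F. \<forall>a\<in>{1..n}. \<exists>f'\<in>F. \<sigma> (f a) = f' (\<sigma> a)"
    and \<rho>_orbit: "\<forall>a\<in>{1..n}. \<exists>f\<in>F. \<rho> a = f (\<sigma> a)"
    and \<rho>: "\<forall>a\<in>{1..n}. \<rho> (\<rho> a) = a \<and> \<rho> a \<noteq> a"
    and a0: "a0 \<in> {1..n}"
    and comm: "\<forall>f\<in>F. \<forall>g\<in>F. f a0 = a0 \<and> g a0 = a0 \<longrightarrow> f \<circ> g \<circ> inv' f \<circ> inv' g = id"
    and fix_comm: "\<forall>f\<in>F. \<forall>g\<in>F. (f \<circ> g \<circ> inv' f \<circ> inv' g) (\<sigma> a0) = \<sigma> a0"
    and insoluble: "\<forall>A f k. subgroup A (sym_group n) \<and> A \<subseteq> F \<and> f \<in> F \<and>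
        (\<forall>b\<in>{1..n}. \<exists>\<alpha>\<in>A. f (\<alpha> (\<sigma> b)) = \<rho> (f b)) \<longrightarrow>
        \<not> (derived (sym_group n) ^^ k) A \<subseteq> {id}"
  shows "\<exists>\<Gamma> \<Gamma>'. uniform_lattice T bar \<Gamma> \<and> \<Gamma> \<subseteq> U \<and> acts_freely T bar \<Gamma> \<and>
     uniform_lattice T bar \<Gamma>' \<and> \<Gamma>' \<subseteq> U \<and> acts_freely T bar \<Gamma>' \<and>
     \<not> (\<exists>\<Lambda>. uniform_lattice T bar \<Lambda> \<and> \<Lambda> \<subseteq> U \<and>
           (\<exists>u\<in>U. conjugate G u \<Gamma> \<subseteq> \<Lambda>) \<and> (\<exists>u\<in>U. conjugate G u \<Gamma>' \<subseteq> \<Lambda>))"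
proof -
  obtain m where m: "labelling \<rho> m" "related m lab"
    using related_labelling_exists[OF \<sigma>_orbit \<rho>_orbit \<rho>] by blast
  have False if \<Lambda>: "uniform_lattice T bar \<Lambda>" "\<Lambda> \<subseteq> U" and u: "u \<in> U" "u' \<in> U"
    and sub: "conjugate G u (label_group lab) \<subseteq> \<Lambda>" "conjugate G u' (label_group m) \<subseteq> \<Lambda>" for \<Lambda> u u'
  proof -
    obtain m1 where m1: "labelling \<sigma> m1" "related m1 lab" "label_group m1 \<subseteq> \<Lambda>"
      using conjugate_labelling[OF labelling_lab related_lab u(1)] sub(1) by blast
    obtain m2 where m2: "labelling \<rho> m2" "related m2 lab" "label_group m2 \<subseteq> \<Lambda>"
      using conjugate_labelling[OF m u(2)] sub(2) by blast
    show False
      by (rule no_common_lattice[OF m1(1,2) m2(1,2) \<Lambda> m1(3) m2(3) a0 comm fix_comm insoluble])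
  qed
  note no_lattice = this
  show ?thesis
  proof (intro exI conjI notI)
    assume "\<exists>\<Lambda>. uniform_lattice T bar \<Lambda> \<and> \<Lambda> \<subseteq> U \<and>
      (\<exists>u\<in>U. conjugate G u (label_group lab) \<subseteq> \<Lambda>) \<and> (\<exists>u\<in>U. conjugate G u (label_group m) \<subseteq> \<Lambda>)"
    then show False using no_lattice by (elim exE conjE bexE)
  qed (rule label_group_uniform_lattice[OF labelling_lab] label_group_uniform_lattice[OF m(1)]
      label_group_free[OF labelling_lab] label_group_free[OF m(1)]
      label_group_universal[OF labelling_lab related_lab] label_group_universal[OF m])+
qed

end

section \<open>An example from the alternating group of degree five\<close>

text \<open>Numbering the elements turns addition modulo \<open>card X\<close> into a cyclic rotation of \<open>X\<close>.\<close>

lemma transitive_int_action_exists: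
  assumes "finite X" "X \<noteq> {}"
  shows "\<exists>rot :: int \<Rightarrow> 'a \<Rightarrow> 'a. \<forall>x\<in>X. rot 0 x = x \<and> (\<forall>q. rot q x \<in> X) \<and>
     (\<forall>q r. rot q (rot r x) = rot (q + r) x) \<and> (\<forall>y\<in>X. \<exists>q. rot q x = y)"
proof -
  obtain h where h: "bij_betw h X {0..<card X}" using ex_bij_betw_finite_nat[OF assms(1)] by blast
  define N where "N = int (card X)"
  have N: "N > 0" using assms by (simp add: N_def card_gt_0_iff)
  define i where "i x = int (h x)" for x
  define j where "j a = inv_into X h (nat (a mod N))" for a
  have j: "j a \<in> X \<and> i (j a) = a mod N" for a
  proof -
    have "nat (a mod N) \<in> {0..<card X}" using N by (auto simp: N_def nat_less_iff)
    then show ?thesis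
      using h N bij_betw_inv_into_right[OF h] inv_into_into[of _ h X]
      by (auto simp: i_def j_def bij_betw_def)
  qed
  have i: "j (i x) = x" if "x \<in> X" for x
    using that h bij_betw_inv_into_left[OF h that] bij_betwE[OF h] by (auto simp: i_def j_def N_def)
  have j_mod: "j (a mod N) = j a" for a by (simp add: j_def)
  show ?thesis
  proof (intro exI[of _ "\<lambda>q x. j (q + i x)"] ballI conjI allI)
    show "j (q + i (j (r + i x))) = j (q + r + i x)" for q r x
      using j j_mod by (metis add.assoc mod_add_right_eq)
    show "\<exists>q. j (q + i x) = y" if "y \<in> X" for x y
      using i[OF that] by (intro exI[of _ "i y - i x"]) simp
  qed (use i j in auto)
qed

text \<open>
  Transport along the numbering \<open>c\<close> of a set of labels, extended by the identity as the elements of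
  \<^const>\<open>sym_group\<close> are.
\<close>

definition "on_labels n c g i = (if i \<in> {1..n} then inv_into {1..n} c (g (c i)) else i)"

lemma on_labels:
  assumes c: "bij_betw c {1..n} L" and g: "g ` L \<subseteq> L" and i: "i \<in> {1..n}"
  shows "on_labels n c g i \<in> {1..n}" "c (on_labels n c g i) = g (c i)"
proof -
  have "g (c i) \<in> L" using bij_betwE[OF c] g i by blast
  then show "on_labels n c g i \<in> {1..n}" "c (on_labels n c g i) = g (c i)"
    using c i inv_into_into[of "g (c i)" c "{1..n}"] bij_betw_inv_into_right[OF c, of "g (c i)"]
    unfolding on_labels_def bij_betw_def by auto
qed

lemma on_labels_comp:
  assumes "bij_betw c {1..n} L" "h ` L \<subseteq> L" "\<And>x. x \<in> L \<Longrightarrow> g (h x) = k x"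
  shows "on_labels n c g \<circ> on_labels n c h = on_labels n c k"
proof
  fix i
  show "(on_labels n c g \<circ> on_labels n c h) i = on_labels n c k i"
    using on_labels[OF assms(1,2), of i] assms(3)[of "c i"] bij_betwE[OF assms(1)]
    by (cases "i \<in> {1..n}") (auto simp: on_labels_def)
qed

lemma on_labels_id:
  assumes "bij_betw c {1..n} L" "\<And>x. x \<in> L \<Longrightarrow> g x = x"
  shows "on_labels n c g = id"
proof
  fix i show "on_labels n c g i = id i"
    using assms(2)[of "c i"] bij_betwE[OF assms(1)] bij_betw_inv_into_left[OF assms(1), of i]
    by (auto simp: on_labels_def)
qed

abbreviation "A5 \<equiv> carrier (alt_group 5)"

lemma A5_closed: "p \<in> A5 \<Longrightarrow> q \<in> A5 \<Longrightarrow> p \<circ> q \<in> A5" "p \<in> A5 \<Longrightarrow> inv' p \<in> A5" "id \<in> A5"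
proof -
  interpret A: group "alt_group 5" by (rule alt_group_is_group)
  show "p \<in> A5 \<Longrightarrow> q \<in> A5 \<Longrightarrow> p \<circ> q \<in> A5" using A.m_closed[of p q] by (simp only: alt_group_mult)
  show "id \<in> A5" using A.one_closed by (simp only: alt_group_one)
qed (rule alt_group_inv_closed)

lemma A5_inverse: "p \<in> A5 \<Longrightarrow> p \<circ> inv' p = id" "p \<in> A5 \<Longrightarrow> inv' p \<circ> p = id" "p \<in> A5 \<Longrightarrow> inv' (inv' p) = p"
  using permutes_inv_o permutes_inv_inv by (auto simp: alt_group_carrier)

text \<open>
  A label \<open>(x, k, s)\<close> is an element \<open>x\<close> of the copy \<open>(k, s)\<close> of the alternating group. The copy
  \<open>(False, True)\<close> is the rotated one, on which \<open>rot\<close> acts; left translations act on the other three.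
\<close>

locale alternating_example =
  fixes n :: nat and c :: "nat \<Rightarrow> (nat \<Rightarrow> nat) \<times> bool \<times> bool" and rot :: "int \<Rightarrow> (nat \<Rightarrow> nat) \<Rightarrow> nat \<Rightarrow> nat"
  assumes c: "bij_betw c {1..n} (A5 \<times> UNIV)"
    and rot_in: "\<And>q x. x \<in> A5 \<Longrightarrow> rot q x \<in> A5"
    and rot_rot: "\<And>q r x. x \<in> A5 \<Longrightarrow> rot q (rot r x) = rot (q + r) x"
    and rot_0: "\<And>x. x \<in> A5 \<Longrightarrow> rot 0 x = x"
    and rot_trans: "\<And>x y. x \<in> A5 \<Longrightarrow> y \<in> A5 \<Longrightarrow> \<exists>q. rot q x = y"
begin

definition act where
  "act p q = (\<lambda>(x, k, s). (if \<not> k \<and> s then rot q x else p \<circ> x, k :: bool, s :: bool))"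

definition "\<phi> p q = on_labels n c (act p q)"
definition "F = {\<phi> p q |p q. p \<in> A5}"
definition "flip = on_labels n c (\<lambda>(x, k, s). (x, k, \<not> s))"
definition "twisted_flip = on_labels n c (\<lambda>(x, k, s). (if k then inv' x else x, k, \<not> s))"
definition "label x k s = inv_into {1..n} c (x, k, s)"

lemma label: "x \<in> A5 \<Longrightarrow> label x k s \<in> {1..n}" "x \<in> A5 \<Longrightarrow> c (label x k s) = (x, k, s)"
  using c inv_into_into[of "(x, k, s)" c "{1..n}"] bij_betw_inv_into_right[OF c, of "(x, k, s)"]
  unfolding label_def bij_betw_def by auto

lemma label_cases:
  assumes "i \<in> {1..n}"
  obtains x k s where "x \<in> A5" "i = label x k s"
proof -
  obtain x k s where x: "c i = (x, k, s)" by (cases "c i")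
  then have "x \<in> A5" using bij_betwE[OF c] assms by force
  moreover have "i = label x k s"
    using bij_betw_inv_into_left[OF c assms] x by (simp add: label_def)
  ultimately show thesis by (rule that)
qed

lemma label_inject:
  assumes "x \<in> A5" "y \<in> A5"
  shows "label x k s = label y k' s' \<longleftrightarrow> x = y \<and> k = k' \<and> s = s'"
proof
  assume "label x k s = label y k' s'"
  then have "(x, k, s) = (y, k', s')"
    using label(2)[OF assms(1), of k s] label(2)[OF assms(2), of k' s'] by (simp only:)
  then show "x = y \<and> k = k' \<and> s = s'" by simp
qed simp

lemma on_labels_label:
  assumes "x \<in> A5"
  shows "on_labels n c g (label x k s) = (case g (x, k, s) of (y, k', s') \<Rightarrow> label y k' s')"
proof -
  have "on_labels n c g (label x k s) = inv_into {1..n} c (g (x, k, s))"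
    unfolding on_labels_def using label[OF assms] by (simp only: if_True)
  then show ?thesis by (cases "g (x, k, s)") (simp only: label_def prod.case)
qed

lemma \<phi>_label: "x \<in> A5 \<Longrightarrow> \<phi> p q (label x k s) = label (if \<not> k \<and> s then rot q x else p \<circ> x) k s"
  by (simp add: \<phi>_def on_labels_label act_def)

lemma flip_label: "x \<in> A5 \<Longrightarrow> flip (label x k s) = label x k (\<not> s)"
  by (simp add: flip_def on_labels_label)

lemma twisted_flip_label: "x \<in> A5 \<Longrightarrow> twisted_flip (label x k s) = label (if k then inv' x else x) k (\<not> s)"
  by (simp add: twisted_flip_def on_labels_label)

lemma \<phi>_comp: "p \<in> A5 \<Longrightarrow> p' \<in> A5 \<Longrightarrow> \<phi> p q \<circ> \<phi> p' q' = \<phi> (p \<circ> p') (q + q')"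
  unfolding \<phi>_def by (rule on_labels_comp[OF c]) (auto simp: act_def rot_rot rot_in A5_closed comp_assoc)

lemma \<phi>_id: "\<phi> id 0 = id"
  unfolding \<phi>_def by (rule on_labels_id[OF c]) (auto simp: act_def rot_0)

lemma \<phi>_inverse:
  assumes "p \<in> A5"
  shows "\<phi> p q \<circ> \<phi> (inv' p) (- q) = id" "\<phi> (inv' p) (- q) \<circ> \<phi> p q = id"
  using assms by (simp_all add: \<phi>_comp A5_closed A5_inverse \<phi>_id)

lemma \<phi>_permutes: "p \<in> A5 \<Longrightarrow> \<phi> p q permutes {1..n}"
proof -
  assume p: "p \<in> A5"
  have "bij (\<phi> p q)" using \<phi>_inverse[OF p] by (rule o_bij[rotated])
  moreover have "\<phi> p q i = i" if "i \<notin> {1..n}" for i using that by (auto simp: \<phi>_def on_labels_def)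
  ultimately show ?thesis unfolding permutes_def bij_iff by blast
qed

lemma inv_\<phi>: "p \<in> A5 \<Longrightarrow> inv' (\<phi> p q) = \<phi> (inv' p) (- q)"
  using \<phi>_inverse by (intro inv_unique_comp)

lemma \<phi>_in_F: "p \<in> A5 \<Longrightarrow> \<phi> p q \<in> F"
  by (auto simp: F_def)

lemma F_is_subgroup: "subgroup F (sym_group n)"
proof (rule group.subgroupI[OF sym_group_is_group])
  show "F \<subseteq> carrier (sym_group n)" using \<phi>_permutes by (auto simp: F_def sym_group_carrier)
  show "F \<noteq> {}" using \<phi>_in_F A5_closed(3) by blast
next
  fix f assume "f \<in> F"
  then obtain p q where "p \<in> A5" "f = \<phi> p q" by (auto simp: F_def)
  then show "inv\<^bsub>sym_group n\<^esub> f \<in> F"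
    using \<phi>_permutes inv_\<phi> \<phi>_in_F A5_closed(2) by (simp add: sym_group_carrier)
next
  fix f g assume "f \<in> F" "g \<in> F"
  then show "f \<otimes>\<^bsub>sym_group n\<^esub> g \<in> F"
    using \<phi>_comp A5_closed(1) unfolding F_def sym_group_mult by fastforce
qed

sublocale word_tree_with_group n flip F
proof (intro word_tree_with_group.intro word_tree_labels.intro word_tree_with_group_axioms.intro)
  fix a assume "a \<in> {1..n}"
  then obtain x k s where "x \<in> A5" "a = label x k s" by (rule label_cases)
  then show "flip a \<in> {1..n}" "flip (flip a) = a" "flip a \<noteq> a"
    using label(1) by (simp_all add: flip_label label_inject del: atLeastAtMost_iff)
qed (rule F_is_subgroup)

lemma F_transitive:
  assumes x: "x \<in> A5" and y: "y \<in> A5"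
  shows "\<exists>f\<in>F. f (label x k s) = label y k s"
proof (cases "\<not> k \<and> s")
  case True
  obtain q where "rot q x = y" using rot_trans[OF x y] by blast
  then show ?thesis using True x \<phi>_in_F[OF A5_closed(3), of q] by (intro bexI[of _ "\<phi> id q"]) (auto simp: \<phi>_label)
next
  case False
  have "y \<circ> inv' x \<circ> x = y" using A5_inverse(2)[OF x] by (simp add: comp_assoc)
  then show ?thesis using False x \<phi>_in_F[of "y \<circ> inv' x" 0] y A5_closed
    by (intro bexI[of _ "\<phi> (y \<circ> inv' x) 0"]) (auto simp: \<phi>_label)
qed

lemma flip_orbit: "\<forall>f\<in>F. \<forall>a\<in>{1..n}. \<exists>f'\<in>F. flip (f a) = f' (flip a)"
proof (intro ballI)
  fix f a assume f: "f \<in> F" and a: "a \<in> {1..n}"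
  obtain p q where pq: "p \<in> A5" "f = \<phi> p q" using f by (auto simp: F_def)
  obtain x k s where x: "x \<in> A5" "a = label x k s" using a by (rule label_cases)
  define y where "y = (if \<not> k \<and> s then rot q x else p \<circ> x)"
  have y: "y \<in> A5" using x(1) pq(1) rot_in A5_closed(1) by (simp add: y_def)
  then have "flip (f a) = label y k (\<not> s)" "flip a = label x k (\<not> s)"
    using x pq by (simp_all add: \<phi>_label flip_label y_def[symmetric])
  then show "\<exists>f'\<in>F. flip (f a) = f' (flip a)" using F_transitive[OF x(1) y] by metis
qed

lemma twisted_flip_orbit: "\<forall>a\<in>{1..n}. \<exists>f\<in>F. twisted_flip a = f (flip a)"
proof
  fix a assume "a \<in> {1..n}"
  then obtain x k s where x: "x \<in> A5" "a = label x k s" by (rule label_cases)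
  define y where "y = (if k then inv' x else x)"
  have y: "y \<in> A5" using x(1) A5_closed(2) by (simp add: y_def)
  have "twisted_flip a = label y k (\<not> s)" "flip a = label x k (\<not> s)"
    using x by (simp_all add: twisted_flip_label flip_label y_def)
  then show "\<exists>f\<in>F. twisted_flip a = f (flip a)" using F_transitive[OF x(1) y] by metis
qed

lemma twisted_flip_involution: "\<forall>a\<in>{1..n}. twisted_flip (twisted_flip a) = a \<and> twisted_flip a \<noteq> a"
proof
  fix a assume "a \<in> {1..n}"
  then obtain x k s where "x \<in> A5" "a = label x k s" by (rule label_cases)
  then show "twisted_flip (twisted_flip a) = a \<and> twisted_flip a \<noteq> a"
    by (simp add: twisted_flip_label label_inject A5_closed A5_inverse)
qed

lemma commutator_\<phi>:
  assumes "p \<in> A5" "p' \<in> A5"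
  shows "\<phi> p q \<circ> \<phi> p' q' \<circ> inv' (\<phi> p q) \<circ> inv' (\<phi> p' q') = \<phi> (p \<circ> p' \<circ> inv' p \<circ> inv' p') 0"
  using assms by (simp add: inv_\<phi> \<phi>_comp A5_closed)

text \<open>Left translations act freely, so a stabiliser in a translated copy consists of rotations.\<close>

lemma stabiliser_abelian:
  "\<forall>f\<in>F. \<forall>g\<in>F. f (label id False False) = label id False False \<and>
     g (label id False False) = label id False False \<longrightarrow> f \<circ> g \<circ> inv' f \<circ> inv' g = id"
proof (intro ballI impI)
  fix f g
  assume fg: "f \<in> F" "g \<in> F" and fix_lab: "f (label id False False) = label id False False \<and>
     g (label id False False) = label id False False"
  obtain p q where f: "p \<in> A5" "f = \<phi> p q" using fg(1) by (auto simp: F_def)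
  obtain p' q' where g: "p' \<in> A5" "g = \<phi> p' q'" using fg(2) by (auto simp: F_def)
  have "p = id" "p' = id"
    using fix_lab f g by (simp_all add: \<phi>_label label_inject A5_closed)
  then show "f \<circ> g \<circ> inv' f \<circ> inv' g = id"
    using f g commutator_\<phi> \<phi>_id by simp
qed

text \<open>On the rotated copy, \<open>F\<close> acts through an abelian group.\<close>

lemma commutators_fix:
  "\<forall>f\<in>F. \<forall>g\<in>F. (f \<circ> g \<circ> inv' f \<circ> inv' g) (flip (label id False False)) = flip (label id False False)"
proof (intro ballI)
  fix f g assume fg: "f \<in> F" "g \<in> F"
  obtain p q where f: "p \<in> A5" "f = \<phi> p q" using fg(1) by (auto simp: F_def)
  obtain p' q' where g: "p' \<in> A5" "g = \<phi> p' q'" using fg(2) by (auto simp: F_def)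
  show "(f \<circ> g \<circ> inv' f \<circ> inv' g) (flip (label id False False)) = flip (label id False False)"
    unfolding f(2) g(2) commutator_\<phi>[OF f(1) g(1)]
    by (simp add: flip_label \<phi>_label A5_closed rot_0)
qed

text \<open>
  The projection of \<open>F\<close> to the alternating group: on a translated copy, the image of the identity is
  the translating element.
\<close>

definition "\<pi> f = fst (c (f (label id True True)))"

lemma \<pi>_\<phi>: "p \<in> A5 \<Longrightarrow> \<pi> (\<phi> p q) = p"
  by (simp add: \<pi>_def \<phi>_label A5_closed label)

lemma \<pi>_hom: "group_hom ((sym_group n)\<lparr>carrier := F\<rparr>) (alt_group 5) \<pi>"
proof (intro group_hom.intro group_hom_axioms.intro)
  show "group ((sym_group n)\<lparr>carrier := F\<rparr>)"
    by (rule group.subgroup_imp_group[OF sym_group_is_group F_is_subgroup])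
  show "\<pi> \<in> hom ((sym_group n)\<lparr>carrier := F\<rparr>) (alt_group 5)"
    by (auto simp: hom_def F_def \<pi>_\<phi> \<phi>_comp A5_closed sym_group_mult alt_group_mult)
qed (rule alt_group_is_group)

text \<open>
  Let \<open>p0\<close> and \<open>p\<close> be the projections of \<open>f\<close> and \<open>\<alpha>\<close>. On the pair of copies \<open>k = True\<close>, the condition
  at \<open>b = (x, True, False)\<close> is \<open>p0 p x = (p0 x)\<^sup>-\<^sup>1\<close>, that is, \<open>p = (x p0)\<^sup>-\<^sup>2\<close>. As \<open>x\<close> varies,
  every square occurs, in particular every three-cycle. The three-cycles generate the alternating
  group, which is its own derived subgroup.
\<close>

lemma forced_insoluble:
  "\<forall>A f k. subgroup A (sym_group n) \<and> A \<subseteq> F \<and> f \<in> F \<and>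
     (\<forall>b\<in>{1..n}. \<exists>\<alpha>\<in>A. f (\<alpha> (flip b)) = twisted_flip (f b)) \<longrightarrow>
     \<not> (derived (sym_group n) ^^ k) A \<subseteq> {id}"
proof (intro allI impI)
  fix A f k
  assume "subgroup A (sym_group n) \<and> A \<subseteq> F \<and> f \<in> F \<and>
     (\<forall>b\<in>{1..n}. \<exists>\<alpha>\<in>A. f (\<alpha> (flip b)) = twisted_flip (f b))"
  then have A: "subgroup A (sym_group n)" "A \<subseteq> F" and f: "f \<in> F"
    and forced: "\<And>b. b \<in> {1..n} \<Longrightarrow> \<exists>\<alpha>\<in>A. f (\<alpha> (flip b)) = twisted_flip (f b)" by auto
  obtain p0 q0 where p0: "p0 \<in> A5" "f = \<phi> p0 q0" using f by (auto simp: F_def)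
  interpret \<pi>: group_hom "(sym_group n)\<lparr>carrier := F\<rparr>" "alt_group 5" \<pi> by (rule \<pi>_hom)
  have cubes: "t \<in> \<pi> ` A" if t: "t \<in> A5" "t \<circ> t \<circ> t = id" for t
  proof -
    \<comment> \<open>For this \<open>x\<close>, the condition \<open>p0 p x = (p0 x)\<^sup>-\<^sup>1\<close> becomes \<open>p = t\<^sup>-\<^sup>2 = t\<close>.\<close>
    define x where "x = t \<circ> inv' p0"
    have x: "x \<in> A5" using t(1) p0(1) A5_closed by (simp add: x_def)
    obtain \<alpha> where \<alpha>: "\<alpha> \<in> A" "f (\<alpha> (flip (label x True False))) = twisted_flip (f (label x True False))"
      using forced label(1)[OF x] by blast
    obtain p q where p: "p \<in> A5" "\<alpha> = \<phi> p q" using \<alpha>(1) A(2) by (auto simp: F_def)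
    have in5: "p \<circ> x \<in> A5" "p0 \<circ> x \<in> A5" "p0 \<circ> (p \<circ> x) \<in> A5" "inv' (p0 \<circ> x) \<in> A5"
      using x p(1) p0(1) A5_closed by auto
    have "p0 \<circ> (p \<circ> x) = inv' (p0 \<circ> x)"
      using \<alpha>(2) x in5 unfolding p0(2) p(2)
      by (simp add: flip_label twisted_flip_label \<phi>_label label_inject del: o_apply)
    then have "(p0 \<circ> (p \<circ> x)) \<circ> (p0 \<circ> x) = id" using A5_inverse(2)[OF in5(2)] by simp
    moreover have "x \<circ> (p0 \<circ> x) = t \<circ> t \<circ> inv' p0"
      using A5_inverse(2)[OF p0(1)] unfolding x_def by (metis comp_assoc comp_id)
    ultimately have "p0 \<circ> (p \<circ> (t \<circ> t \<circ> inv' p0)) = id" by (metis comp_assoc)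
    then have "inv' p0 \<circ> (p0 \<circ> (p \<circ> (t \<circ> t \<circ> inv' p0))) = inv' p0" by simp
    then have "p \<circ> (t \<circ> t \<circ> inv' p0) = inv' p0"
      by (simp only: comp_assoc[symmetric] A5_inverse(2)[OF p0(1)] id_comp)
    then have "p \<circ> (t \<circ> t \<circ> inv' p0) \<circ> p0 = id" by (simp only: A5_inverse(2)[OF p0(1)])
    then have "p \<circ> (t \<circ> t) = id"
      by (simp only: comp_assoc A5_inverse(2)[OF p0(1)] comp_id)
    then have "p = t" using t(2) by (metis comp_assoc comp_id id_comp)
    then show ?thesis using \<alpha>(1) p \<pi>_\<phi> by (metis imageI)
  qed
  have three: "three_cycles 5 \<subseteq> \<pi> ` A"
  proof
    fix t assume t: "t \<in> three_cycles 5"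
    then obtain cs where cs: "t = cycle_of_list cs" "cycle cs" "length cs = 3" by auto
    have "t ^^ 3 = id" using cycle_is_id_root[OF cs(2)] cs by simp
    then have "t \<circ> t \<circ> t = id" by (simp add: numeral_3_eq_3 comp_assoc)
    then show "t \<in> \<pi> ` A" using cubes three_cycles_incl[of 5] t by blast
  qed
  have "subgroup A ((sym_group n)\<lparr>carrier := F\<rparr>)"
    using group.subgroup_incl[OF sym_group_is_group A(1) F_is_subgroup A(2)] .
  then have sub: "subgroup (\<pi> ` A) (alt_group 5)" by (rule \<pi>.subgroup_img_is_subgroup)
  have img: "\<pi> ` A = A5"
  proof
    show "\<pi> ` A \<subseteq> A5" by (rule subgroup.subset[OF sub])
    show "A5 \<subseteq> \<pi> ` A"
      using group.generate_subgroup_incl[OF alt_group_is_group three sub]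
      by (simp only: alt_group_carrier_as_three_cycles[of 5])
  qed
  have "A5 = (derived (alt_group 5) ^^ k) A5"
    by (induction k) (simp_all add: derived_alt_group_const)
  also have "\<dots> = \<pi> ` ((derived ((sym_group n)\<lparr>carrier := F\<rparr>) ^^ k) A)"
    unfolding img[symmetric] using A(2) by (intro \<pi>.exp_of_derived_img) simp
  also have "(derived ((sym_group n)\<lparr>carrier := F\<rparr>) ^^ k) A = (derived (sym_group n) ^^ k) A"
    by (rule group.exp_of_derived_consistent[OF sym_group_is_group F_is_subgroup A(2)])
  finally have A5: "A5 = \<pi> ` (derived (sym_group n) ^^ k) A" .
  show "\<not> (derived (sym_group n) ^^ k) A \<subseteq> {id}"
  proof
    assume "(derived (sym_group n) ^^ k) A \<subseteq> {id}"
    then have "A5 \<subseteq> {\<pi> id}" using A5 by blast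
    then have "card A5 \<le> 1" using card_mono[of "{\<pi> id}" A5] by simp
    moreover have "2 * card A5 = fact 5" by (rule alt_group_card_carrier) simp
    ultimately show False by (simp add: fact_numeral)
  qed
qed

lemmas alternating_example_lattices = incompatible_lattices[OF flip_orbit twisted_flip_orbit twisted_flip_involution
    label(1)[OF A5_closed(3)] stabiliser_abelian commutators_fix forced_insoluble]

end

theorem theorem3p14:
  shows "\<exists>(n::nat) (F :: (nat \<Rightarrow> nat) set) (\<tau> :: nat set \<Rightarrow> nat set)
           (T :: (nat list, nat list \<times> nat list) pre_digraph) bar l \<Gamma> \<Gamma>'.
     n \<ge> 3 \<and> subgroup F (sym_group n) \<and> orbit_involution n F \<tau> \<and>
     regular_tree n T bar \<and> legal_labelling n F \<tau> T bar l \<and>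
     uniform_lattice T bar \<Gamma> \<and> \<Gamma> \<subseteq> universal_group n F T bar l \<and> acts_freely T bar \<Gamma> \<and>
     uniform_lattice T bar \<Gamma>' \<and> \<Gamma>' \<subseteq> universal_group n F T bar l \<and> acts_freely T bar \<Gamma>' \<and>
     \<not> (\<exists>\<Lambda>. uniform_lattice T bar \<Lambda> \<and> \<Lambda> \<subseteq> universal_group n F T bar l \<and>
           (\<exists>u\<in>universal_group n F T bar l. conjugate (aut_group T bar) u \<Gamma> \<subseteq> \<Lambda>) \<and>
           (\<exists>u\<in>universal_group n F T bar l. conjugate (aut_group T bar) u \<Gamma>' \<subseteq> \<Lambda>))"
proof -
  have fin: "finite A5" and ne: "A5 \<noteq> {}"
    using alt_group_card_carrier[of 5] A5_closed(3) card.infinite[of A5] by (auto simp: fact_numeral)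
  define n where "n = card (A5 \<times> (UNIV :: (bool \<times> bool) set))"
  have "card (UNIV :: (bool \<times> bool) set) = 4"
    by (simp add: UNIV_Times_UNIV[symmetric] card_cartesian_product del: UNIV_Times_UNIV)
  then have "n = 240"
    using alt_group_card_carrier[of 5] by (simp add: n_def card_cartesian_product fact_numeral)
  then have n: "n \<ge> 3" by simp
  obtain c :: "nat \<Rightarrow> (nat \<Rightarrow> nat) \<times> bool \<times> bool" where c: "bij_betw c {1..n} (A5 \<times> UNIV)"
    using finite_same_card_bij[of "{1..n}" "A5 \<times> (UNIV :: (bool \<times> bool) set)"] fin
    by (auto simp: n_def)
  obtain rot :: "int \<Rightarrow> (nat \<Rightarrow> nat) \<Rightarrow> nat \<Rightarrow> nat" where rot:
    "\<forall>x\<in>A5. rot 0 x = x \<and> (\<forall>q. rot q x \<in> A5) \<and>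
       (\<forall>q r. rot q (rot r x) = rot (q + r) x) \<and> (\<forall>y\<in>A5. \<exists>q. rot q x = y)"
    using transitive_int_action_exists[OF fin ne] by blast
  interpret alternating_example n c rot
  proof (rule alternating_example.intro[OF c])
    fix x assume "x \<in> A5"
    note rot_x = bspec[OF rot this]
    show "rot q x \<in> A5" "rot q (rot r x) = rot (q + r) x" "rot 0 x = x" for q r
      using rot_x by simp_all
    show "\<exists>q. rot q x = y" if "y \<in> A5" for y using rot_x that by simp
  qed
  have "\<exists>\<Gamma> \<Gamma>'. n \<ge> 3 \<and> subgroup F (sym_group n) \<and> orbit_involution n F ((`) flip) \<and>
     regular_tree n T bar \<and> legal_labelling n F ((`) flip) T bar lab \<and>
     uniform_lattice T bar \<Gamma> \<and> \<Gamma> \<subseteq> U \<and> acts_freely T bar \<Gamma> \<and>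
     uniform_lattice T bar \<Gamma>' \<and> \<Gamma>' \<subseteq> U \<and> acts_freely T bar \<Gamma>' \<and>
     \<not> (\<exists>\<Lambda>. uniform_lattice T bar \<Lambda> \<and> \<Lambda> \<subseteq> U \<and>
           (\<exists>u\<in>U. conjugate G u \<Gamma> \<subseteq> \<Lambda>) \<and> (\<exists>u\<in>U. conjugate G u \<Gamma>' \<subseteq> \<Lambda>))"
    by (simp only: n F_is_subgroup orbit_involution_image[OF flip_orbit] regular_T legal_lab
        alternating_example_lattices simp_thms)
  then show ?thesis
    by (intro exI[of _ n] exI[of _ F] exI[of _ "(`) flip"] exI[of _ T] exI[of _ bar] exI[of _ lab])
qed

end
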